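(* Suppose that the loss $L(\theta)$ is bounded from below by $L_{\inf}$ in some open subset of its domain, that $g$ is $C^1$ with respect to all variables, that the gradients of $g$ with respect to $\theta$ and $y$ are $L_\theta$- and $L_y$-Lipschitz, respectively, and that the second-order partial derivatives of $g$ with respect to $\theta$ exist. Let $\epsilon_p>0$ and suppose the approximate fixed points satisfy $\|(\tilde y_\theta(z)-z)+\nabla_y g_\theta(\tilde y_\theta(z))\|<\epsilon_p$ for all $\theta$ and $z$, and that $\int\|x\|^2\,d\mu(x)<\infty$ and $\int\|z\|^2\,d\nu(z)<\infty$. Suppose further that for some $0<V<1$, for all $\theta$ and all $z$, $$\|\tilde y_\theta(z)-y_\theta^*(z)\|<\epsilon\le\frac{V\,\|\nabla_\theta L(\theta)\|^2}{L_\theta\big(\sqrt{M_x}+\sqrt{M_z}\big)},$$ where $\epsilon$ does not depend on $z$ but may depend on $\theta$, and put $U=1-V$. Suppose the sequence of learning rates $\{\alpha_j\}_{j=0}^\infty$ is monotonically decreasing and satisfies $\sum_{j=0}^\infty\alpha_j=\infty$, $\sum_{j=0}^\infty\alpha_j^2<\infty$ and $0<\alpha_0\le\frac{UM_L}{L_\theta\tilde M}$. Let $\{\theta_j\}$ be given by the SGD iteration $\theta_{j+1}=\theta_j-\alpha_j\tilde d_{\xi_j}(\theta_j)$, $j\ge0$. For any $K\in\mathbb{N}$ let $j(K)\in\{0,1,\dots,K\}$ be a random index chosen with probabilities proportional to $\{\alpha_j\}_{j=0}^K$. Then $\|\nabla_\theta L(\theta_{j(K)})\|\to0$ in probability as 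$K\to\infty$.
   Context: $\mu,\nu$ are probability measures on $\mathbb{R}^d$. $g:\mathbb{R}^p\times\mathbb{R}^d\to\mathbb{R}$, $(\theta,y)\mapsto g_\theta(y)$, is a parameterized potential with $\theta\in\mathbb{R}^p$, convex in $y$ for each $\theta$. Its gradients with respect to $\theta$ and $y$ are regarded as functions of $(\theta,y)$. $\frac{\partial g_\theta}{\partial\theta}(y)$ is the partial gradient in $\theta$ at fixed $y$. For $z\in\mathbb{R}^d$, $y_\theta^*(z)$ is the unique minimizer of $y\mapsto\frac12\|y-z\|^2+g_\theta(y)$, and $\tilde y_\theta(z)$ (measurable) is an approximation of it. The loss is $$L(\theta)=\mathbb{E}_{x\sim\mu}[g_\theta(x)]-\mathbb{E}_{z\sim\nu}\Big[\tfrac12\|y_\theta^*(z)-z\|^2+g_\theta(y_\theta^*(z))\Big],$$ whose gradient is $\nabla_\theta L(\theta)=\mathbb{E}_{x\sim\mu}\big[\frac{\partial g_\theta}{\partial\theta}(x)\big]-\mathbb{E}_{z\sim\nu}\big[\frac{\partial g_\theta}{\partial\theta}(y_\theta^*(z))\big]$. Constants: $M_x,M_z\in(0,\infty)$ are such that for all $\theta$: $\mathbb{E}_{x\sim\mu}\big[\|\frac{\partial g_\theta}{\partial\theta}(x)\|^2\big]<M_x$, $\mathbb{E}_{z\sim\nu}\big[\|\frac{\partial g_\theta}{\partial\theta}(\tilde y_\theta(z))\|^2\big]<M_z$, $\mathbb{E}_{z\sim\nu}\big[\|\frac{\partial g_\theta}{\partial\theta}(y_\theta^*(z))\|^2\big]<M_z$;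 $\tilde M=M_x+M_z+2\sqrt{M_xM_z}$; and $M_L\in(0,\infty)$ is such that $\|\nabla_\theta L(\theta)\|^2\le M_L$ for all $\theta$. SGD: $\xi_0,\xi_1,\dots$ are independent random variables; $\xi_j$ consists of i.i.d. samples $x_1,\dots,x_B\sim\mu$ and $z_1,\dots,z_B\sim\nu$ ($B\ge1$), and $\tilde d_{\xi_j}(\theta)=\frac1B\sum_{i=1}^B\frac{\partial g_\theta}{\partial\theta}(x_i)-\frac1B\sum_{i=1}^B\frac{\partial g_\theta}{\partial\theta}(\tilde y_\theta(z_i))$. $\alpha_j>0$ are deterministic learning rates and $\theta_0$ is given. The random index $j(K)$ is drawn independently of $\xi_0,\xi_1,\dots$, with $P(j(K)=j)=\alpha_j/\sum_{i=0}^K\alpha_i$. *)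

theory Defs
  imports "HOL-Probability.Probability"
begin

definition grad :: "('a::real_inner \<Rightarrow> real) \<Rightarrow> 'a \<Rightarrow> 'a" where
  "grad f x = (THE D. GDERIV f x :> D)"

definition C1 :: "('a::real_inner \<Rightarrow> real) \<Rightarrow> bool" where
  "C1 f \<longleftrightarrow> (\<exists>G. (\<forall>x. GDERIV f x :> G x) \<and> continuous_on UNIV G)"

definition grad_theta ::
    "(real ^ 'p \<Rightarrow> real ^ 'd \<Rightarrow> real) \<Rightarrow> real ^ 'p \<Rightarrow> real ^ 'd \<Rightarrow> real ^ 'p" where
  "grad_theta g \<theta> y = grad (\<lambda>\<phi>. g \<phi> y) \<theta>"

definition grad_y ::
    "(real ^ 'p \<Rightarrow> real ^ 'd \<Rightarrow> real) \<Rightarrow> real ^ 'p \<Rightarrow> real ^ 'd \<Rightarrow> real ^ 'd" where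
  "grad_y g \<theta> y = grad (\<lambda>v. g \<theta> v) y"

text \<open>Existence of all second-order partial derivatives in \<open>\<theta>\<close>: every component \<open>i\<close> of the
  \<open>\<theta>\<close>-gradient has a partial derivative along every coordinate direction \<open>k\<close>. Neither
  differentiability in the Frechet sense nor continuity is required.\<close>

definition has_second_partials_theta :: "(real ^ 'p \<Rightarrow> real ^ 'd \<Rightarrow> real) \<Rightarrow> bool" where
  "has_second_partials_theta g \<longleftrightarrow>
    (\<forall>\<theta> y i k. (\<lambda>t::real. grad_theta g (\<theta> + t *\<^sub>R axis k 1) y $ i) differentiable (at 0))"

text \<open>The objective is strongly convex and continuous for the potentials considered, so its
  minimizer exists and is unique.\<close>

definition y_star ::
    "(real ^ 'p \<Rightarrow> real ^ 'd \<Rightarrow> real) \<Rightarrow> real ^ 'p \<Rightarrow> real ^ 'd \<Rightarrow> real ^ 'd" where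
  "y_star g \<theta> z = arg_min_on (\<lambda>y. 1/2 * (norm (y - z))\<^sup>2 + g \<theta> y) UNIV"

definition loss ::
    "(real ^ 'p \<Rightarrow> real ^ 'd \<Rightarrow> real) \<Rightarrow> (real ^ 'd) measure \<Rightarrow> (real ^ 'd) measure
      \<Rightarrow> real ^ 'p \<Rightarrow> real" where
  "loss g \<mu> \<nu> \<theta> =
    (\<integral>x. g \<theta> x \<partial>\<mu>)
    - (\<integral>z. 1/2 * (norm (y_star g \<theta> z - z))\<^sup>2 + g \<theta> (y_star g \<theta> z) \<partial>\<nu>)"

text \<open>A minibatch is a pair of families \<open>(x\<^sub>1, \<dots>, x\<^sub>B)\<close> and \<open>(z\<^sub>1, \<dots>, z\<^sub>B)\<close>; its law makes all
  \<open>2B\<close> samples independent.\<close>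

definition batch_law ::
    "nat \<Rightarrow> 'a measure \<Rightarrow> 'a measure \<Rightarrow> ((nat \<Rightarrow> 'a) \<times> (nat \<Rightarrow> 'a)) measure" where
  "batch_law B \<mu> \<nu> = (\<Pi>\<^sub>M i\<in>{1..B}. \<mu>) \<Otimes>\<^sub>M (\<Pi>\<^sub>M i\<in>{1..B}. \<nu>)"

definition sgd_dir ::
    "(real ^ 'p \<Rightarrow> real ^ 'd \<Rightarrow> real) \<Rightarrow> (real ^ 'p \<Rightarrow> real ^ 'd \<Rightarrow> real ^ 'd) \<Rightarrow> nat
      \<Rightarrow> (nat \<Rightarrow> real ^ 'd) \<times> (nat \<Rightarrow> real ^ 'd) \<Rightarrow> real ^ 'p \<Rightarrow> real ^ 'p" where
  "sgd_dir g yt B s \<theta> =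
    (1 / real B) *\<^sub>R (\<Sum>i=1..B. grad_theta g \<theta> (fst s i))
    - (1 / real B) *\<^sub>R (\<Sum>i=1..B. grad_theta g \<theta> (yt \<theta> (snd s i)))"

text \<open>\<^const>\<open>prob_space.indep_var\<close> only relates random variables with values in the same type;
  this is the same notion for different types. Since \<^const>\<open>prob_space.indep_set\<close> requires
  both families to consist of events, \<open>X\<close> and \<open>Y\<close> are measurable.\<close>

definition indep_rvs ::
    "'w measure \<Rightarrow> 'a measure \<Rightarrow> ('w \<Rightarrow> 'a) \<Rightarrow> 'b measure \<Rightarrow> ('w \<Rightarrow> 'b) \<Rightarrow> bool" where
  "indep_rvs M N X N' Y \<longleftrightarrow>
    X \<in> space M \<rightarrow> space N \<and> Y \<in> space M \<rightarrow> space N' \<and>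
    prob_space.indep_set M
      {X -` A \<inter> space M | A. A \<in> sets N} {Y -` A \<inter> space M | A. A \<in> sets N'}"

text \<open>Measurability is part of the notion, since \<^const>\<open>measure\<close> vanishes on
  non-measurable sets.\<close>

definition tendsto_in_prob ::
    "'w measure \<Rightarrow> (nat \<Rightarrow> 'w \<Rightarrow> real) \<Rightarrow> real \<Rightarrow> bool" where
  "tendsto_in_prob M X c \<longleftrightarrow>
    (\<forall>n. X n \<in> borel_measurable M) \<and>
    (\<forall>e>0. (\<lambda>n. measure M {\<omega> \<in> space M. \<bar>X n \<omega> - c\<bar> > e}) \<longlonglongrightarrow> 0)"

end

theory Submission
  imports Defs
begin

text \<open>The minimum \<open>h\<^sub>\<theta>(z)\<close> of \<open>1/2 \<parallel>y - z\<parallel>\<^sup>2 + g\<^sub>\<theta>(y)\<close> is taken over a strongly convex function, so the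
  minimizer is Lipschitz in \<open>(\<theta>, z)\<close>. Hence \<open>h\<^sub>\<theta>\<close>, and with it the loss \<open>L\<close>, differs from its first-order
  expansion in \<open>\<theta>\<close> by at most a constant times the squared step; this yields both the formula for
  \<open>\<nabla>L\<close> and a descent inequality. Testing the minimum with \<open>y = x\<close> for an independent pair
  \<open>(x, z)\<close> shows that \<open>L\<close> is bounded below by minus a transport cost, which is finite because of the second
  moments. The approximation error of the inner minimizer costs at most a fraction \<open>V\<close> of
  \<open>\<parallel>\<nabla>L\<parallel>\<^sup>2\<close> in the expected decrease, so \<open>E \<Phi>(\<theta>\<^sub>j\<^sub>+\<^sub>1) + \<alpha>\<^sub>j U E \<parallel>\<nabla>L(\<theta>\<^sub>j)\<parallel>\<^sup>2 \<le> E \<Phi>(\<theta>\<^sub>j) + c \<alpha>\<^sub>j\<^sup>2\<close> with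
  \<open>\<Phi> = L - m\<close> for a lower bound \<open>m\<close>. Telescoping bounds \<open>\<Sum> \<alpha>\<^sub>j E \<parallel>\<nabla>L(\<theta>\<^sub>j)\<parallel>\<^sup>2\<close>, and since \<open>j(K)\<close> has weights
  \<open>\<alpha>\<^sub>j / \<Sum> \<alpha>\<^sub>i\<close> with divergent denominator, Markov's inequality gives convergence in probability.\<close>

section \<open>Gradients and the inner minimizer\<close>

lemma grad_eqI: "GDERIV f x :> D \<Longrightarrow> grad f x = D"
  unfolding grad_def
proof (rule the_equality)
  fix D' assume "GDERIV f x :> D" "GDERIV f x :> D'"
  then have "(\<lambda>h. h \<bullet> D) = (\<lambda>h. h \<bullet> D')"
    unfolding gderiv_def by (rule has_derivative_unique)
  from fun_cong[OF this, of "D - D'"] have "(D - D') \<bullet> (D - D') = 0"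
    by (simp add: inner_diff_right)
  then show "D' = D" by simp
qed

text \<open>Restricting \<open>f\<close> to the line through \<open>x\<close> and \<open>y\<close>
  reduces the claim to one real variable. Keeping the intermediate point on the segment lets
  Lipschitz bounds there be expressed by \<open>norm (y - x)\<close>.\<close>

lemma GDERIV_mean_value:
  fixes f :: "'a::real_inner \<Rightarrow> real"
  assumes "\<And>x. GDERIV f x :> G x"
  obtains w where "w \<in> closed_segment x y" "f y - f x = (y - x) \<bullet> G w"
proof -
  define \<phi> where "\<phi> t = f (x + t *\<^sub>R (y - x))" for t :: real
  have "(\<phi> has_derivative (\<lambda>h. (h *\<^sub>R (y - x)) \<bullet> G (x + t *\<^sub>R (y - x)))) (at t)" for t
  proof -
    have "((\<lambda>t. x + t *\<^sub>R (y - x)) has_derivative (\<lambda>h. h *\<^sub>R (y - x))) (at t)"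
      by (auto intro!: derivative_eq_intros)
    from has_derivative_compose[OF this assms[unfolded gderiv_def]]
    show ?thesis unfolding \<phi>_def .
  qed
  then have "\<exists>t\<in>{0<..<1}. \<phi> 1 - \<phi> 0 = ((1 - 0) *\<^sub>R (y - x)) \<bullet> G (x + t *\<^sub>R (y - x))"
    by (intro mvt_simple) (auto intro: has_derivative_at_withinI)
  then obtain t where t: "0 < t" "t < 1" "\<phi> 1 - \<phi> 0 = (y - x) \<bullet> G (x + t *\<^sub>R (y - x))"
    by auto
  show thesis
  proof
    show "x + t *\<^sub>R (y - x) \<in> closed_segment x y"
      using t unfolding in_segment
      by (intro exI[of _ t]) (auto simp: algebra_simps)
    show "f y - f x = (y - x) \<bullet> G (x + t *\<^sub>R (y - x))"
      using t by (simp add: \<phi>_def)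
  qed
qed

text \<open>The increment equals \<open>(y - x) \<bullet> G w\<close> with \<open>w\<close> no
  farther from \<open>x\<close> than \<open>y\<close> is. Integration along the segment would give
  \<open>C / 2\<close>; any fixed multiple of the squared step suffices here.\<close>

lemma GDERIV_quadratic_error:
  fixes f :: "'a::real_inner \<Rightarrow> real"
  assumes "\<And>x. GDERIV f x :> G x"
    and "\<And>x y. norm (G x - G y) \<le> C * norm (x - y)" and "0 \<le> C"
  shows "\<bar>f y - f x - (y - x) \<bullet> G x\<bar> \<le> C * (norm (y - x))\<^sup>2"
proof -
  obtain w where w: "w \<in> closed_segment x y" "f y - f x = (y - x) \<bullet> G w"
    using GDERIV_mean_value assms(1) by blast
  have "\<bar>f y - f x - (y - x) \<bullet> G x\<bar> = \<bar>(y - x) \<bullet> (G w - G x)\<bar>"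
    using w by (simp add: inner_diff_right)
  also have "\<dots> \<le> norm (y - x) * norm (G w - G x)"
    by (rule Cauchy_Schwarz_ineq2)
  also have "\<dots> \<le> norm (y - x) * (C * norm (w - x))"
    by (intro mult_left_mono assms) auto
  also have "\<dots> \<le> norm (y - x) * (C * norm (y - x))"
    using assms(3) segment_bound(1)[OF w(1)]
    by (intro mult_left_mono) (auto simp: norm_minus_commute)
  finally show ?thesis by (simp add: power2_eq_square mult_ac)
qed

text \<open>A quadratic remainder divided by \<open>norm (y - x)\<close> tends to zero. This
  identifies the gradient of the loss without differentiating under an integral sign.\<close>

lemma GDERIV_if_quadratic_error:
  fixes f :: "'a::real_inner \<Rightarrow> real"
  assumes "\<And>y. \<bar>f y - f x - (y - x) \<bullet> G\<bar> \<le> C * (norm (y - x))\<^sup>2"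
  shows "GDERIV f x :> G"
  unfolding gderiv_def has_derivative_at2
proof (intro conjI)
  show "bounded_linear (\<lambda>h. h \<bullet> G)" by (rule bounded_linear_inner_left)
  have "((\<lambda>y. C * norm (y - x)) \<longlongrightarrow> C * norm (x - x)) (at x)"
    by (intro tendsto_intros)
  then have "((\<lambda>y. C * norm (y - x)) \<longlongrightarrow> 0) (at x)" by simp
  then show "((\<lambda>y. (1 / norm (y - x)) *\<^sub>R (f y - (f x + (y - x) \<bullet> G))) \<longlongrightarrow> 0) (at x)"
  proof (rule Lim_null_comparison[rotated], intro always_eventually allI)
    fix y
    have "norm ((1 / norm (y - x)) *\<^sub>R (f y - (f x + (y - x) \<bullet> G)))
        = \<bar>f y - f x - (y - x) \<bullet> G\<bar> / norm (y - x)"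
      by (simp add: diff_diff_eq)
    also have "\<dots> \<le> C * (norm (y - x))\<^sup>2 / norm (y - x)"
      by (rule divide_right_mono[OF assms]) simp
    \<comment> \<open>At \<open>y = x\<close> both sides vanish, since division by zero gives
      zero.\<close>
    also have "\<dots> = C * norm (y - x)" by (simp add: power2_eq_square)
    finally show "norm ((1 / norm (y - x)) *\<^sub>R (f y - (f x + (y - x) \<bullet> G))) \<le> C * norm (y - x)" .
  qed
qed

text \<open>Composing with the embeddings of the two factors exhibits the partial gradients as
  components of the full one. Hence the definite descriptions behind \<open>grad_theta\<close> and
  \<open>grad_y\<close> denote actual gradients.\<close>

lemma C1_slices:
  fixes g :: "'a::real_inner \<Rightarrow> 'b::real_inner \<Rightarrow> real"
  assumes "C1 (\<lambda>(\<theta>, y). g \<theta> y)"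
  shows "\<exists>D. GDERIV (\<lambda>\<phi>. g \<phi> y) \<theta> :> D" "\<exists>D. GDERIV (g \<theta>) y :> D"
proof -
  obtain G where G: "\<And>x. GDERIV (\<lambda>(\<theta>, y). g \<theta> y) x :> G x"
    using assms unfolding C1_def by blast
  have 1: "((\<lambda>\<phi>. (\<phi>, y)) has_derivative (\<lambda>h. (h, 0))) (at \<theta>)"
    and 2: "((\<lambda>v. (\<theta>, v)) has_derivative (\<lambda>h. (0, h))) (at y)"
    by (auto intro!: derivative_eq_intros)
  note G' = G[of "(\<theta>, y)", unfolded gderiv_def]
  have "GDERIV (\<lambda>\<phi>. g \<phi> y) \<theta> :> fst (G (\<theta>, y))"
    using has_derivative_compose[OF 1 G'] unfolding gderiv_def by (simp add: inner_prod_def)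
  then show "\<exists>D. GDERIV (\<lambda>\<phi>. g \<phi> y) \<theta> :> D" ..
  have "GDERIV (g \<theta>) y :> snd (G (\<theta>, y))"
    using has_derivative_compose[OF 2 G'] unfolding gderiv_def by (simp add: inner_prod_def)
  then show "\<exists>D. GDERIV (g \<theta>) y :> D" ..
qed

section \<open>Convex potentials with Lipschitz gradients\<close>

locale potential =
  fixes g :: "real ^ 'p \<Rightarrow> real ^ 'd \<Rightarrow> real" and L_theta L_y :: real
  assumes convex: "\<And>\<theta>. convex_on UNIV (g \<theta>)"
    and g_C1: "C1 (\<lambda>(\<theta>, y). g \<theta> y)"
    and lip_theta: "L_theta-lipschitz_on UNIV (\<lambda>(\<theta>, y). grad_theta g \<theta> y)"
    and lip_y: "L_y-lipschitz_on UNIV (\<lambda>(\<theta>, y). grad_y g \<theta> y)"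
begin

lemma L_theta_nonneg: "0 \<le> L_theta" and L_y_nonneg: "0 \<le> L_y"
  using lip_theta lip_y lipschitz_on_nonneg by blast+

lemma GDERIV_theta: "GDERIV (\<lambda>\<phi>. g \<phi> y) \<theta> :> grad_theta g \<theta> y"
proof -
  obtain D where D: "GDERIV (\<lambda>\<phi>. g \<phi> y) \<theta> :> D"
    using C1_slices(1)[OF g_C1] by blast
  then show ?thesis unfolding grad_theta_def grad_eqI[OF D] .
qed

lemma GDERIV_y: "GDERIV (g \<theta>) y :> grad_y g \<theta> y"
proof -
  obtain D where D: "GDERIV (g \<theta>) y :> D"
    using C1_slices(2)[OF g_C1] by blast
  then show ?thesis unfolding grad_y_def grad_eqI[OF D] .
qed

text \<open>The product norm is at most the sum of the norms, so the joint Lipschitz condition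
  controls each variable separately.\<close>

lemma grad_theta_lipschitz:
  "norm (grad_theta g \<theta> y - grad_theta g \<theta>' y') \<le> L_theta * (norm (\<theta> - \<theta>') + norm (y - y'))"
proof -
  have "norm (grad_theta g \<theta> y - grad_theta g \<theta>' y') \<le> L_theta * norm ((\<theta>, y) - (\<theta>', y'))"
    using lipschitz_on_normD[OF lip_theta, of "(\<theta>, y)" "(\<theta>', y')"] by simp
  also have "\<dots> \<le> L_theta * (norm (\<theta> - \<theta>') + norm (y - y'))"
    by (intro mult_left_mono L_theta_nonneg) (simp add: norm_Pair sqrt_sum_squares_le_sum)
  finally show ?thesis .
qed

lemma grad_y_lipschitz: "norm (grad_y g \<theta> y - grad_y g \<theta> y') \<le> L_y * norm (y - y')"
  using lipschitz_on_normD[OF lip_y, of "(\<theta>, y)" "(\<theta>, y')"] by (simp add: norm_Pair)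

lemma continuous_grad_theta: "continuous_on UNIV (\<lambda>(\<theta>, y). grad_theta g \<theta> y)"
  using lip_theta by (rule lipschitz_on_continuous_on)

lemma continuous_g: "continuous_on UNIV (\<lambda>(\<theta>, y). g \<theta> y)"
proof -
  obtain G where G: "\<And>x. GDERIV (\<lambda>(\<theta>, y). g \<theta> y) x :> G x"
    using g_C1 unfolding C1_def by blast
  show ?thesis
  proof (rule has_derivative_continuous_on)
    show "((\<lambda>(\<theta>, y). g \<theta> y) has_derivative (\<lambda>h. h \<bullet> G x)) (at x within UNIV)" for x
      using G[of x] unfolding gderiv_def by simp
  qed
qed

lemma g_theta_quadratic:
  "\<bar>g \<theta>' y - g \<theta> y - (\<theta>' - \<theta>) \<bullet> grad_theta g \<theta> y\<bar> \<le> L_theta * (norm (\<theta>' - \<theta>))\<^sup>2"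
  using GDERIV_quadratic_error[of "\<lambda>\<phi>. g \<phi> y" "\<lambda>\<phi>. grad_theta g \<phi> y" L_theta \<theta>' \<theta>]
    GDERIV_theta grad_theta_lipschitz[of _ y _ y] L_theta_nonneg by simp

lemma g_y_quadratic:
  "\<bar>g \<theta> y' - g \<theta> y - (y' - y) \<bullet> grad_y g \<theta> y\<bar> \<le> L_y * (norm (y' - y))\<^sup>2"
  using GDERIV_quadratic_error[of "g \<theta>" "grad_y g \<theta>" L_y y' y]
    GDERIV_y grad_y_lipschitz L_y_nonneg by simp

text \<open>This replaces a bound on mixed second derivatives: the mean value theorem in \<theta> is
  applied to the difference of two slices, whose gradient is small because \<open>grad_theta\<close>
  is Lipschitz in \<open>y\<close>.\<close>

lemma g_mixed_difference:
  "(g \<theta>' y' - g \<theta> y') - (g \<theta>' y - g \<theta> y) \<le> L_theta * norm (\<theta>' - \<theta>) * norm (y' - y)"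
proof -
  have "GDERIV (\<lambda>\<phi>. g \<phi> y' - g \<phi> y) \<phi> :> grad_theta g \<phi> y' - grad_theta g \<phi> y" for \<phi>
    by (intro GDERIV_diff GDERIV_theta)
  from GDERIV_mean_value[of "\<lambda>\<phi>. g \<phi> y' - g \<phi> y", OF this]
  obtain w where w: "(g \<theta>' y' - g \<theta>' y) - (g \<theta> y' - g \<theta> y)
      = (\<theta>' - \<theta>) \<bullet> (grad_theta g w y' - grad_theta g w y)" .
  have "(\<theta>' - \<theta>) \<bullet> (grad_theta g w y' - grad_theta g w y)
      \<le> norm (\<theta>' - \<theta>) * norm (grad_theta g w y' - grad_theta g w y)"
    by (rule norm_cauchy_schwarz)
  also have "\<dots> \<le> norm (\<theta>' - \<theta>) * (L_theta * norm (y' - y))"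
    using grad_theta_lipschitz[of w y' w y] by (intro mult_left_mono) auto
  finally show ?thesis using w by (simp add: algebra_simps)
qed

section \<open>The proximal objective, its minimizer and the Moreau envelope\<close>

definition obj :: "real ^ 'p \<Rightarrow> real ^ 'd \<Rightarrow> real ^ 'd \<Rightarrow> real" where
  "obj \<theta> z y = 1/2 * (norm (y - z))\<^sup>2 + g \<theta> y"

definition moreau_env :: "real ^ 'p \<Rightarrow> real ^ 'd \<Rightarrow> real" where
  "moreau_env \<theta> z = obj \<theta> z (y_star g \<theta> z)"

text \<open>By convexity, \<open>g \<theta>\<close> falls at most linearly along rays from
  \<open>z\<close>, at rate \<open>g \<theta> z - m\<close> with \<open>m\<close> a lower bound on
  the unit ball around \<open>z\<close>. Far out the quadratic term wins.\<close>

lemma obj_coercive: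
  obtains R where "\<And>y. R < norm (y - z) \<Longrightarrow> obj \<theta> z z \<le> obj \<theta> z y"
proof -
  obtain m where m: "\<And>y. y \<in> cball z 1 \<Longrightarrow> m \<le> g \<theta> y"
  proof -
    have "continuous_on (cball z 1) (g \<theta>)"
      using continuous_on_compose2[OF continuous_g, of "cball z 1" "\<lambda>y. (\<theta>, y)"]
      by (simp add: continuous_on_Pair continuous_on_const continuous_on_id)
    then have "\<exists>x\<in>cball z 1. \<forall>y\<in>cball z 1. g \<theta> x \<le> g \<theta> y"
      by (intro continuous_attains_inf) auto
    then show thesis using that by blast
  qed
  show thesis
  proof
    \<comment> \<open>The threshold 1 puts \<open>y\<close> outside the unit ball; the other one
      makes half the squared distance exceed the possible linear decrease.\<close>
    fix y assume r: "max 1 (2 * (g \<theta> z - m)) < norm (y - z)"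
    define r where "r = norm (y - z)"
    have r1: "1 < r" "2 * (g \<theta> z - m) < r" using r by (auto simp: r_def)
    \<comment> \<open>\<open>u\<close> is the point at distance one from \<open>z\<close> on the
      segment from \<open>z\<close> to \<open>y\<close>.\<close>
    define u where "u = (1 - 1 / r) *\<^sub>R z + (1 / r) *\<^sub>R y"
    have "u - z = (1 / r) *\<^sub>R (y - z)" by (simp add: u_def algebra_simps)
    then have "norm (u - z) = 1"
      using r1 by (simp add: r_def[symmetric])
    then have "m \<le> g \<theta> u" by (intro m) (simp add: dist_norm norm_minus_commute)
    also have "g \<theta> u \<le> (1 - 1 / r) * g \<theta> z + (1 / r) * g \<theta> y"
      unfolding u_def using r1 by (intro convex_onD[OF convex]) auto
    finally have "r * m \<le> r * ((1 - 1 / r) * g \<theta> z + (1 / r) * g \<theta> y)"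
      using r1 by (intro mult_left_mono) auto
    also have "\<dots> = (r - 1) * g \<theta> z + g \<theta> y" using r1 by (simp add: field_simps)
    finally have "g \<theta> z - g \<theta> y \<le> r * (g \<theta> z - m)" by (simp add: algebra_simps)
    also have "\<dots> \<le> r * (r / 2)" using r1 by (intro mult_left_mono) auto
    finally show "obj \<theta> z z \<le> obj \<theta> z y"
      unfolding obj_def r_def by (simp add: power2_eq_square)
  qed
qed

text \<open>Outside a large ball the centre \<open>z\<close> is already no worse, so a minimum over
  the compact ball is global. The radius \<open>max 0 R\<close> ensures that the ball contains
  \<open>z\<close>.\<close>

lemma obj_attains_min: "\<exists>y. \<forall>y'. obj \<theta> z y \<le> obj \<theta> z y'"
proof -
  obtain R where R: "\<And>y. R < norm (y - z) \<Longrightarrow> obj \<theta> z z \<le> obj \<theta> z y"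
    using obj_coercive by blast
  have "continuous_on (cball z (max 0 R)) (obj \<theta> z)"
    unfolding obj_def
    using continuous_on_compose2[OF continuous_g, of "cball z (max 0 R)" "\<lambda>y. (\<theta>, y)"]
    by (auto intro!: continuous_intros simp: continuous_on_Pair)
  then have "\<exists>x\<in>cball z (max 0 R). \<forall>y\<in>cball z (max 0 R). obj \<theta> z x \<le> obj \<theta> z y"
    by (intro continuous_attains_inf) auto
  then obtain x where x: "\<And>y. norm (y - z) \<le> max 0 R \<Longrightarrow> obj \<theta> z x \<le> obj \<theta> z y"
    unfolding Ball_def mem_cball dist_norm norm_minus_commute[of z] by blast
  have "obj \<theta> z x \<le> obj \<theta> z y" for y
  proof (cases "norm (y - z) \<le> max 0 R")
    case False
    then have "obj \<theta> z z \<le> obj \<theta> z y" by (intro R) auto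
    with x[of z] show ?thesis by auto
  qed (rule x)
  then show ?thesis by blast
qed

text \<open>Attainment of the minimum is what makes the point selected by \<open>arg_min_on\<close>
  a genuine minimizer.\<close>

lemma moreau_env_le: "moreau_env \<theta> z \<le> obj \<theta> z y"
proof -
  obtain w where w: "\<And>y. obj \<theta> z w \<le> obj \<theta> z y"
    using obj_attains_min by blast
  have "obj \<theta> z (arg_min (obj \<theta> z) (\<lambda>_. True)) \<le> obj \<theta> z y"
    by (rule arg_minI[where P = "\<lambda>_. True" and x = w]) (use w in \<open>auto simp: not_less\<close>)
  then show ?thesis
    unfolding moreau_env_def y_star_def arg_min_on_def obj_def by simp
qed

text \<open>Midpoint convexity gives only the factor \<open>1/4\<close> instead of the optimal \<open>1/2\<close>, which suffices for Lipschitz continuity.\<close>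

lemma obj_growth: "moreau_env \<theta> z + 1/4 * (norm (y - y_star g \<theta> z))\<^sup>2 \<le> obj \<theta> z y"
proof -
  define x where "x = y_star g \<theta> z"
  have "moreau_env \<theta> z \<le> obj \<theta> z ((1/2) *\<^sub>R x + (1/2) *\<^sub>R y)" by (rule moreau_env_le)
  moreover have "g \<theta> ((1/2) *\<^sub>R x + (1/2) *\<^sub>R y) \<le> 1/2 * g \<theta> x + 1/2 * g \<theta> y"
    using convex_onD[OF convex, of "1/2" x y \<theta>] by simp
  \<comment> \<open>Parallelogram identity: at the midpoint the squared norm lies below the average
    by a quarter of the squared distance, which is the source of the growth.\<close>
  moreover have "(norm ((1/2) *\<^sub>R x + (1/2) *\<^sub>R y - z))\<^sup>2
      = 1/2 * (norm (x - z))\<^sup>2 + 1/2 * (norm (y - z))\<^sup>2 - 1/4 * (norm (y - x))\<^sup>2"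
    unfolding power2_norm_eq_inner by (simp add: algebra_simps inner_commute)
  ultimately have "2 * moreau_env \<theta> z + 1/4 * (norm (y - x))\<^sup>2 \<le> obj \<theta> z x + obj \<theta> z y"
    unfolding obj_def by argo
  then show ?thesis unfolding x_def moreau_env_def by simp
qed

text \<open>Each minimum is tested with the other minimizer and the growth bounds are added. What
  survives is an inner product and a mixed difference of \<open>g\<close>, both bounded linearly in
  the distance \<open>n\<close> of the minimizers, against a quadratic term in
  \<open>n\<close>.\<close>

lemma y_star_lipschitz:
  "norm (y_star g \<theta>' z' - y_star g \<theta> z) \<le> 2 * (L_theta * norm (\<theta>' - \<theta>) + norm (z' - z))"
proof -
  define y y' where "y = y_star g \<theta> z" and "y' = y_star g \<theta>' z'"
  define n where "n = norm (y' - y)"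
  have "obj \<theta> z y + 1/4 * n\<^sup>2 \<le> obj \<theta> z y'" "obj \<theta>' z' y' + 1/4 * n\<^sup>2 \<le> obj \<theta>' z' y"
    using obj_growth[of \<theta> z y'] obj_growth[of \<theta>' z' y]
    unfolding moreau_env_def y_def y'_def n_def by (auto simp: norm_minus_commute)
  then have "1/2 * n\<^sup>2 \<le> (z' - z) \<bullet> (y' - y) + ((g \<theta> y' - g \<theta>' y') - (g \<theta> y - g \<theta>' y))"
    unfolding obj_def power2_norm_eq_inner by (simp add: algebra_simps inner_commute)
  also have "\<dots> \<le> norm (z' - z) * n + L_theta * norm (\<theta>' - \<theta>) * n"
    unfolding n_def
    using norm_cauchy_schwarz[of "z' - z" "y' - y"] g_mixed_difference[of \<theta> y' \<theta>' y]
    by (simp add: norm_minus_commute)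
  finally have "n * n \<le> n * (2 * (L_theta * norm (\<theta>' - \<theta>) + norm (z' - z)))"
    by (simp add: power2_eq_square algebra_simps)
  \<comment> \<open>For \<open>n = 0\<close> only nonnegativity of the right-hand side is claimed;
    otherwise \<open>n\<close> cancels.\<close>
  then have "n \<le> 2 * (L_theta * norm (\<theta>' - \<theta>) + norm (z' - z))"
    using L_theta_nonneg by (cases "n = 0") (auto simp: n_def)
  then show ?thesis by (simp add: n_def y_def y'_def)
qed

lemma continuous_y_star: "continuous_on UNIV (\<lambda>(\<theta>, z). y_star g \<theta> z)"
proof (rule lipschitz_on_continuous_on, rule lipschitz_onI)
  fix x x' :: "(real^'p) \<times> (real^'d)"
  obtain \<theta> z \<theta>' z' where x: "x = (\<theta>, z)" "x' = (\<theta>', z')" by fastforce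
  have "dist \<theta> \<theta>' \<le> dist x x'" "dist z z' \<le> dist x x'"
    using dist_fst_le[of x x'] dist_snd_le[of x x'] x by auto
  then have "2 * (L_theta * dist \<theta> \<theta>' + dist z z') \<le> 2 * (L_theta * dist x x' + dist x x')"
    using L_theta_nonneg by (intro mult_left_mono add_mono) auto
  with y_star_lipschitz[of \<theta> z \<theta>' z']
  show "dist (case x of (\<theta>, z) \<Rightarrow> y_star g \<theta> z) (case x' of (\<theta>, z) \<Rightarrow> y_star g \<theta> z)
      \<le> (2 * L_theta + 2) * dist x x'"
    unfolding x by (simp add: dist_norm algebra_simps)
qed (use L_theta_nonneg in auto)

text \<open>An envelope theorem with remainder. Testing each minimum with the other minimizer
  encloses the increment between the increments of \<open>g\<close> at \<open>y'\<close> and at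
  \<open>y\<close>. Passing from \<open>y'\<close> to \<open>y\<close> costs the extra
  \<open>2 * L_theta\<^sup>2\<close>, because the minimizer moves by at most
  \<open>2 * L_theta * norm d\<close>.\<close>

lemma moreau_env_quadratic:
  "\<bar>moreau_env \<theta>' z - moreau_env \<theta> z - (\<theta>' - \<theta>) \<bullet> grad_theta g \<theta> (y_star g \<theta> z)\<bar>
    \<le> (L_theta + 2 * L_theta\<^sup>2) * (norm (\<theta>' - \<theta>))\<^sup>2"
proof -
  define y y' where "y = y_star g \<theta> z" and "y' = y_star g \<theta>' z"
  define d where "d = \<theta>' - \<theta>"
  have "moreau_env \<theta>' z \<le> obj \<theta>' z y" by (rule moreau_env_le)
  also have "\<dots> = moreau_env \<theta> z + (g \<theta>' y - g \<theta> y)" by (simp add: moreau_env_def obj_def y_def)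
  finally have upper: "moreau_env \<theta>' z - moreau_env \<theta> z - d \<bullet> grad_theta g \<theta> y \<le> L_theta * (norm d)\<^sup>2"
    using g_theta_quadratic[of \<theta>' y \<theta>] by (simp add: d_def)
  have "moreau_env \<theta> z \<le> obj \<theta> z y'" by (rule moreau_env_le)
  also have "\<dots> = moreau_env \<theta>' z - (g \<theta>' y' - g \<theta> y')" by (simp add: moreau_env_def obj_def y'_def)
  finally have "d \<bullet> grad_theta g \<theta> y' - L_theta * (norm d)\<^sup>2 \<le> moreau_env \<theta>' z - moreau_env \<theta> z"
    using g_theta_quadratic[of \<theta>' y' \<theta>] by (simp add: d_def)
  moreover have "d \<bullet> grad_theta g \<theta> y - d \<bullet> grad_theta g \<theta> y' \<le> 2 * L_theta\<^sup>2 * (norm d)\<^sup>2"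
  proof -
    have "d \<bullet> grad_theta g \<theta> y - d \<bullet> grad_theta g \<theta> y'
        \<le> norm d * norm (grad_theta g \<theta> y - grad_theta g \<theta> y')"
      using norm_cauchy_schwarz[of d "grad_theta g \<theta> y - grad_theta g \<theta> y'"]
      by (simp add: inner_diff_right)
    also have "\<dots> \<le> norm d * (L_theta * norm (y' - y))"
      using grad_theta_lipschitz[of \<theta> y \<theta> y']
      by (intro mult_left_mono) (auto simp: norm_minus_commute)
    also have "\<dots> \<le> norm d * (L_theta * (2 * (L_theta * norm d)))"
      using y_star_lipschitz[of \<theta>' z \<theta> z] L_theta_nonneg
      by (intro mult_left_mono) (auto simp: y_def y'_def d_def)
    finally show ?thesis by (simp add: power2_eq_square mult_ac)
  qed
  ultimately have lower: "- ((L_theta + 2 * L_theta\<^sup>2) * (norm d)\<^sup>2)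
      \<le> moreau_env \<theta>' z - moreau_env \<theta> z - d \<bullet> grad_theta g \<theta> y"
    by (simp add: algebra_simps)
  have "L_theta * (norm d)\<^sup>2 \<le> (L_theta + 2 * L_theta\<^sup>2) * (norm d)\<^sup>2"
    by (intro mult_right_mono) auto
  with upper lower show ?thesis unfolding d_def y_def by simp
qed

text \<open>Expansion at the origin; quadratic growth is integrable against laws with second
  moments.\<close>

lemma g_growth:
  "\<bar>g \<theta> y\<bar> \<le> \<bar>g \<theta> 0\<bar> + norm (grad_y g \<theta> 0) * norm y + L_y * (norm y)\<^sup>2"
  using g_y_quadratic[of \<theta> y 0] Cauchy_Schwarz_ineq2[of y "grad_y g \<theta> 0"]
  by (simp add: mult.commute)

end

section \<open>Stochastic iterations with a random index\<close>

text \<open>Running the recursion on a deterministic noise sequence shows which coordinates of the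
  noise an iterate depends on, and so makes independence available.\<close>

primrec iterate :: "(nat \<Rightarrow> 's \<Rightarrow> 'a \<Rightarrow> 'a) \<Rightarrow> 'a \<Rightarrow> (nat \<Rightarrow> 's) \<Rightarrow> nat \<Rightarrow> 'a" where
  "iterate step x0 s 0 = x0"
| "iterate step x0 s (Suc j) = step j (s j) (iterate step x0 s j)"

lemma iterate_cong: "(\<And>i. i < j \<Longrightarrow> s i = s' i) \<Longrightarrow> iterate step x0 s j = iterate step x0 s' j"
  by (induction j) auto

text \<open>The index set is left open because two choices occur: \<open>{..<j}\<close> separates
  the past from batch \<open>j\<close>, and all indices separate the iterates from the random
  index.\<close>

lemma measurable_iterate:
  assumes "x0 \<in> space N" "{..<j} \<subseteq> I"
    and step: "\<And>j. (\<lambda>(s, x). step j s x) \<in> \<beta> \<Otimes>\<^sub>M N \<rightarrow>\<^sub>M N"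
  shows "(\<lambda>s. iterate step x0 s j) \<in> (\<Pi>\<^sub>M i\<in>I. \<beta>) \<rightarrow>\<^sub>M N"
  using assms(2)
proof (induction j)
  case 0
  then show ?case using assms(1) by simp
next
  case (Suc j)
  then have "{..<j} \<subseteq> I" "j \<in> I" by auto
  then have "(\<lambda>s. (s j, iterate step x0 s j)) \<in> (\<Pi>\<^sub>M i\<in>I. \<beta>) \<rightarrow>\<^sub>M \<beta> \<Otimes>\<^sub>M N"
    by (intro measurable_Pair measurable_component_singleton Suc.IH)
  from measurable_compose[OF this step[of j]] show ?case by simp
qed

section \<open>Recursions driven by independent, identically distributed noise\<close>

locale stochastic_iteration = prob_space M for M :: "'w measure" +
  fixes \<beta> :: "'s measure" and \<xi> :: "nat \<Rightarrow> 'w \<Rightarrow> 's"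
    and N :: "'a measure" and step :: "nat \<Rightarrow> 's \<Rightarrow> 'a \<Rightarrow> 'a" and x0 :: 'a and \<Theta> :: "nat \<Rightarrow> 'w \<Rightarrow> 'a"
  assumes \<xi>_law: "\<And>j. distr M \<beta> (\<xi> j) = \<beta>"
    and \<xi>_indep: "indep_vars (\<lambda>_. \<beta>) \<xi> UNIV"
    and x0: "x0 \<in> space N"
    and step_measurable: "\<And>j. (\<lambda>(s, x). step j s x) \<in> \<beta> \<Otimes>\<^sub>M N \<rightarrow>\<^sub>M N"
    and \<Theta>_0: "\<And>\<omega>. \<omega> \<in> space M \<Longrightarrow> \<Theta> 0 \<omega> = x0"
    and \<Theta>_Suc: "\<And>j \<omega>. \<omega> \<in> space M \<Longrightarrow> \<Theta> (Suc j) \<omega> = step j (\<xi> j \<omega>) (\<Theta> j \<omega>)"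
begin

lemma \<xi>_measurable [measurable]: "\<xi> j \<in> M \<rightarrow>\<^sub>M \<beta>"
  using \<xi>_indep by (auto simp: indep_vars_def)

lemma prob_space_\<beta>: "prob_space \<beta>"
  using prob_space_distr[OF \<xi>_measurable] \<xi>_law by metis

lemma \<Theta>_eq_iterate: "\<omega> \<in> space M \<Longrightarrow> \<Theta> j \<omega> = iterate step x0 (\<lambda>i. \<xi> i \<omega>) j"
  by (induction j) (simp_all add: \<Theta>_0 \<Theta>_Suc)

lemma \<Theta>_measurable [measurable]: "\<Theta> j \<in> M \<rightarrow>\<^sub>M N"
proof -
  have "(\<lambda>\<omega> i. \<xi> i \<omega>) \<in> M \<rightarrow>\<^sub>M (\<Pi>\<^sub>M i\<in>UNIV. \<beta>)"
    by (rule measurable_PiM_single') (auto dest: measurable_space[OF \<xi>_measurable])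
  from measurable_compose[OF this measurable_iterate[OF x0 _ step_measurable]]
  show ?thesis by (simp cong: measurable_cong add: \<Theta>_eq_iterate)
qed

text \<open>\<open>\<Theta> j\<close> is a function of the first \<open>j\<close> noise variables,
  hence independent of \<open>\<xi> j\<close>. The fresh noise can therefore be integrated out
  first, which plays the part of conditioning on the past.\<close>

lemma nn_integral_\<Theta>_\<xi>:
  assumes f: "f \<in> borel_measurable (N \<Otimes>\<^sub>M \<beta>)"
  shows "(\<integral>\<^sup>+\<omega>. f (\<Theta> j \<omega>, \<xi> j \<omega>) \<partial>M) = (\<integral>\<^sup>+\<omega>. \<integral>\<^sup>+s. f (\<Theta> j \<omega>, s) \<partial>\<beta> \<partial>M)"
proof -
  interpret \<beta>: prob_space \<beta> by (rule prob_space_\<beta>)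
  \<comment> \<open>Two blocks indexed by truth values, the past and the present: independence of a
    pair is expressed in this format.\<close>
  define I where "I b = (if b then {..<j} else {j})" for b
  define X Y where "X \<omega> = (\<lambda>i\<in>{..<j}. \<xi> i \<omega>)" and "Y \<omega> = (\<lambda>i\<in>{j}. \<xi> i \<omega>)" for \<omega>
  let ?T = "\<lambda>s. iterate step x0 s j"
  have "indep_vars (\<lambda>b. \<Pi>\<^sub>M i\<in>I b. \<beta>) (\<lambda>b \<omega>. \<lambda>i\<in>I b. \<xi> i \<omega>) UNIV"
    by (rule indep_vars_restrict[OF \<xi>_indep]) (auto simp: I_def disjoint_family_on_def)
  then have ind: "indep_var (\<Pi>\<^sub>M i\<in>{..<j}. \<beta>) X (\<Pi>\<^sub>M i\<in>{j}. \<beta>) Y"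
    unfolding indep_var_def X_def Y_def
    by (rule indep_vars_cong[THEN iffD1, rotated -1]) (auto simp: I_def split: bool.split)
  note X [measurable] = indep_var_rv1[OF ind] and Y [measurable] = indep_var_rv2[OF ind]
  have T [measurable]: "?T \<in> (\<Pi>\<^sub>M i\<in>{..<j}. \<beta>) \<rightarrow>\<^sub>M N"
    by (rule measurable_iterate[OF x0 _ step_measurable]) simp
  have \<Theta>X: "\<Theta> j \<omega> = ?T (X \<omega>)" if "\<omega> \<in> space M" for \<omega>
    unfolding \<Theta>_eq_iterate[OF that] by (rule iterate_cong) (simp add: X_def)
  have \<xi>Y: "\<xi> j \<omega> = Y \<omega> j" for \<omega> by (simp add: Y_def)
  interpret Y: prob_space "distr M (\<Pi>\<^sub>M i\<in>{j}. \<beta>) Y" by (rule prob_space_distr) simp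
  let ?F = "\<lambda>(x, y). f (?T x, y j)"
  have F: "?F \<in> borel_measurable ((\<Pi>\<^sub>M i\<in>{..<j}. \<beta>) \<Otimes>\<^sub>M (\<Pi>\<^sub>M i\<in>{j}. \<beta>))"
    using f by measurable
  have "(\<integral>\<^sup>+\<omega>. f (\<Theta> j \<omega>, \<xi> j \<omega>) \<partial>M) = (\<integral>\<^sup>+\<omega>. ?F (X \<omega>, Y \<omega>) \<partial>M)"
    by (intro nn_integral_cong) (simp add: \<Theta>X \<xi>Y)
  also have "\<dots> = (\<integral>\<^sup>+p. ?F p \<partial>distr M ((\<Pi>\<^sub>M i\<in>{..<j}. \<beta>) \<Otimes>\<^sub>M (\<Pi>\<^sub>M i\<in>{j}. \<beta>)) (\<lambda>\<omega>. (X \<omega>, Y \<omega>)))"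
    using F by (subst nn_integral_distr) auto
  \<comment> \<open>Independence turns the joint law into a product, to which Tonelli's theorem
    applies.\<close>
  also have "\<dots> = (\<integral>\<^sup>+p. ?F p \<partial>(distr M (\<Pi>\<^sub>M i\<in>{..<j}. \<beta>) X \<Otimes>\<^sub>M distr M (\<Pi>\<^sub>M i\<in>{j}. \<beta>) Y))"
    using ind unfolding indep_var_distribution_eq by simp
  also have "\<dots> = (\<integral>\<^sup>+x. \<integral>\<^sup>+y. ?F (x, y) \<partial>distr M (\<Pi>\<^sub>M i\<in>{j}. \<beta>) Y \<partial>distr M (\<Pi>\<^sub>M i\<in>{..<j}. \<beta>) X)"
    using F by (intro Y.nn_integral_fst[symmetric]) simp
  also have "\<dots> = (\<integral>\<^sup>+\<omega>. \<integral>\<^sup>+y. ?F (X \<omega>, y) \<partial>distr M (\<Pi>\<^sub>M i\<in>{j}. \<beta>) Y \<partial>M)"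
    using F by (subst nn_integral_distr) (auto intro!: Y.borel_measurable_nn_integral_fst)
  also have "\<dots> = (\<integral>\<^sup>+\<omega>. \<integral>\<^sup>+s. f (\<Theta> j \<omega>, s) \<partial>\<beta> \<partial>M)"
  proof (rule nn_integral_cong)
    fix \<omega> assume \<omega>: "\<omega> \<in> space M"
    then have TX: "?T (X \<omega>) \<in> space N" "\<Theta> j \<omega> = ?T (X \<omega>)"
      using measurable_space[OF \<Theta>_measurable \<omega>, of j] \<Theta>X[OF \<omega>] by auto
    have f': "(\<lambda>s. f (?T (X \<omega>), s)) \<in> borel_measurable \<beta>"
      using f TX by measurable
    have f'': "(\<lambda>y. f (?T (X \<omega>), y j)) \<in> borel_measurable (\<Pi>\<^sub>M i\<in>{j}. \<beta>)"
      using measurable_compose[OF measurable_component_singleton[of j "{j}" "\<lambda>_. \<beta>"] f'] by simp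
    have "(\<integral>\<^sup>+y. ?F (X \<omega>, y) \<partial>distr M (\<Pi>\<^sub>M i\<in>{j}. \<beta>) Y) = (\<integral>\<^sup>+\<omega>'. f (?T (X \<omega>), \<xi> j \<omega>') \<partial>M)"
      using f'' by (simp add: nn_integral_distr \<xi>Y)
    also have "\<dots> = (\<integral>\<^sup>+s. f (?T (X \<omega>), s) \<partial>distr M \<beta> (\<xi> j))"
      using f' by (simp add: nn_integral_distr)
    finally show "(\<integral>\<^sup>+y. ?F (X \<omega>, y) \<partial>distr M (\<Pi>\<^sub>M i\<in>{j}. \<beta>) Y) = (\<integral>\<^sup>+s. f (\<Theta> j \<omega>, s) \<partial>\<beta>)"
      by (simp add: \<xi>_law TX)
  qed
  finally show ?thesis .
qed

text \<open>The descent inequality at \<open>\<Theta> n\<close> is integrated over the fresh noise,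
  then over the past, and telescoped by induction. Extended nonnegative reals with all terms added
  avoid integrability questions for \<open>\<Phi>\<close> along the iterates.\<close>

lemma expected_decrease_sum:
  assumes \<Phi> [measurable]: "\<Phi> \<in> borel_measurable N" and W [measurable]: "W \<in> borel_measurable N"
    and descent: "\<And>j x. x \<in> space N \<Longrightarrow>
      (\<integral>\<^sup>+s. \<Phi> (step j s x) \<partial>\<beta>) + a j * W x \<le> \<Phi> x + (b j :: ennreal)"
  shows "(\<integral>\<^sup>+\<omega>. \<Phi> (\<Theta> n \<omega>) \<partial>M) + (\<Sum>j<n. a j * (\<integral>\<^sup>+\<omega>. W (\<Theta> j \<omega>) \<partial>M)) \<le> \<Phi> x0 + (\<Sum>j<n. b j)"
proof (induction n)
  case 0
  have "(\<integral>\<^sup>+\<omega>. \<Phi> (\<Theta> 0 \<omega>) \<partial>M) = (\<integral>\<^sup>+\<omega>. \<Phi> x0 \<partial>M)"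
    by (intro nn_integral_cong) (simp add: \<Theta>_0)
  then show ?case by (simp add: emeasure_space_1)
next
  case (Suc n)
  let ?E = "\<lambda>j. \<integral>\<^sup>+\<omega>. \<Phi> (\<Theta> j \<omega>) \<partial>M"
  let ?A = "\<lambda>n. \<Sum>j<n. a j * (\<integral>\<^sup>+\<omega>. W (\<Theta> j \<omega>) \<partial>M)"
  have m: "(\<lambda>(x, s). \<Phi> (step n s x)) \<in> borel_measurable (N \<Otimes>\<^sub>M \<beta>)"
    using step_measurable[of n] by measurable
  interpret \<beta>: prob_space \<beta> by (rule prob_space_\<beta>)
  have [measurable]: "(\<lambda>x. \<integral>\<^sup>+s. \<Phi> (step n s x) \<partial>\<beta>) \<in> borel_measurable N"
    using \<beta>.borel_measurable_nn_integral_fst[OF m] by simp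
  have "?E (Suc n) = (\<integral>\<^sup>+\<omega>. \<Phi> (step n (\<xi> n \<omega>) (\<Theta> n \<omega>)) \<partial>M)"
    by (intro nn_integral_cong) (simp add: \<Theta>_Suc)
  also have "\<dots> = (\<integral>\<^sup>+\<omega>. \<integral>\<^sup>+s. \<Phi> (step n s (\<Theta> n \<omega>)) \<partial>\<beta> \<partial>M)"
    using nn_integral_\<Theta>_\<xi>[OF m] by simp
  finally have "?E (Suc n) + a n * (\<integral>\<^sup>+\<omega>. W (\<Theta> n \<omega>) \<partial>M)
      = (\<integral>\<^sup>+\<omega>. (\<integral>\<^sup>+s. \<Phi> (step n s (\<Theta> n \<omega>)) \<partial>\<beta>) + a n * W (\<Theta> n \<omega>) \<partial>M)"
    by (simp add: nn_integral_add nn_integral_cmult)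
  also have "\<dots> \<le> (\<integral>\<^sup>+\<omega>. \<Phi> (\<Theta> n \<omega>) + b n \<partial>M)"
    by (intro nn_integral_mono descent measurable_space[OF \<Theta>_measurable])
  also have "\<dots> = ?E n + b n"
    by (simp add: nn_integral_add emeasure_space_1)
  finally have le: "?E (Suc n) + a n * (\<integral>\<^sup>+\<omega>. W (\<Theta> n \<omega>) \<partial>M) \<le> ?E n + b n" .
  have "?E (Suc n) + ?A (Suc n) = (?E (Suc n) + a n * (\<integral>\<^sup>+\<omega>. W (\<Theta> n \<omega>) \<partial>M)) + ?A n"
    by (simp add: ac_simps)
  also have "\<dots> \<le> (?E n + b n) + ?A n" by (rule add_right_mono[OF le])
  also have "\<dots> = (?E n + ?A n) + b n" by (simp add: ac_simps)
  also have "\<dots> \<le> (\<Phi> x0 + (\<Sum>j<n. b j)) + b n" by (intro add_right_mono Suc.IH)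
  finally show ?case by (simp add: ac_simps)
qed

text \<open>The event is split by the value of the index. Each \<open>\<Theta> j\<close> is a
  measurable function of the whole noise sequence, from which \<open>Jx\<close> is independent, so
  the probabilities multiply.\<close>

lemma prob_random_index:
  fixes K :: nat and Jx :: "'w \<Rightarrow> nat"
  assumes J_range: "\<And>\<omega>. \<omega> \<in> space M \<Longrightarrow> Jx \<omega> \<le> K"
    and J_indep: "indep_rvs M (count_space UNIV) Jx (\<Pi>\<^sub>M j\<in>UNIV. \<beta>) (\<lambda>\<omega> j. \<xi> j \<omega>)"
    and P: "{x \<in> space N. P x} \<in> sets N"
  shows "{\<omega> \<in> space M. P (\<Theta> (Jx \<omega>) \<omega>)} \<in> events"
    "prob {\<omega> \<in> space M. P (\<Theta> (Jx \<omega>) \<omega>)}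
      = (\<Sum>j\<le>K. prob {\<omega> \<in> space M. Jx \<omega> = j} * prob {\<omega> \<in> space M. P (\<Theta> j \<omega>)})"
proof -
  define A where "A j = {\<omega> \<in> space M. Jx \<omega> = j}" for j
  define B where "B j = {\<omega> \<in> space M. P (\<Theta> j \<omega>)}" for j
  note ind = J_indep[unfolded indep_rvs_def, THEN conjunct2, THEN conjunct2]
  have AJ: "A j \<in> {Jx -` C \<inter> space M |C. C \<in> sets (count_space UNIV)}" for j
    by (auto simp: A_def intro!: exI[of _ "{j}"])
  have B\<xi>: "B j \<in> {(\<lambda>\<omega> j. \<xi> j \<omega>) -` C \<inter> space M |C. C \<in> sets (\<Pi>\<^sub>M j\<in>UNIV. \<beta>)}" for j
  proof -
    let ?T = "\<lambda>s. iterate step x0 s j"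
    have T: "?T \<in> (\<Pi>\<^sub>M j\<in>UNIV. \<beta>) \<rightarrow>\<^sub>M N"
      by (rule measurable_iterate[OF x0 _ step_measurable]) simp
    have "?T -` {x \<in> space N. P x} \<inter> space (\<Pi>\<^sub>M j\<in>UNIV. \<beta>) \<in> sets (\<Pi>\<^sub>M j\<in>UNIV. \<beta>)"
      by (rule measurable_sets[OF T P])
    moreover have "B j = (\<lambda>\<omega> j. \<xi> j \<omega>) -` (?T -` {x \<in> space N. P x} \<inter> space (\<Pi>\<^sub>M j\<in>UNIV. \<beta>)) \<inter> space M"
      using measurable_space[OF \<Theta>_measurable, of _ j] measurable_space[OF \<xi>_measurable]
      by (auto simp: B_def \<Theta>_eq_iterate space_PiM)
    ultimately show ?thesis by blast
  qed
  have ev: "A j \<inter> B j \<in> events" for j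
    by (rule sets.Int[OF subsetD[OF indep_setD_ev1[OF ind] AJ] subsetD[OF indep_setD_ev2[OF ind] B\<xi>]])
  have eq: "{\<omega> \<in> space M. P (\<Theta> (Jx \<omega>) \<omega>)} = (\<Union>j\<in>{..K}. A j \<inter> B j)"
    using J_range by (auto simp: A_def B_def)
  show "{\<omega> \<in> space M. P (\<Theta> (Jx \<omega>) \<omega>)} \<in> events"
    unfolding eq using ev by blast
  have "prob (\<Union>j\<in>{..K}. A j \<inter> B j) = (\<Sum>j\<le>K. prob (A j \<inter> B j))"
    using ev by (intro finite_measure_finite_Union) (auto simp: disjoint_family_on_def A_def)
  also have "\<dots> = (\<Sum>j\<le>K. prob (A j) * prob (B j))"
    using indep_setD[OF ind AJ B\<xi>] by simp
  finally show "prob {\<omega> \<in> space M. P (\<Theta> (Jx \<omega>) \<omega>)}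
      = (\<Sum>j\<le>K. prob {\<omega> \<in> space M. Jx \<omega> = j} * prob {\<omega> \<in> space M. P (\<Theta> j \<omega>)})"
    unfolding eq A_def B_def .
qed

text \<open>The exceedance probability at the random index is an average of those at fixed indices
  with weights proportional to \<open>\<alpha>\<close>. Markov's inequality and the telescoped
  descent bound its numerator uniformly in \<open>K\<close>, while the denominator diverges.\<close>

lemma tendsto_in_prob_random_index:
  fixes \<Phi> h :: "'a \<Rightarrow> real" and \<alpha> :: "nat \<Rightarrow> real" and J :: "nat \<Rightarrow> 'w \<Rightarrow> nat"
  assumes \<Phi> [measurable]: "\<Phi> \<in> borel_measurable N"
    and h [measurable]: "h \<in> borel_measurable N"
    and \<alpha>_pos: "\<And>j. 0 < \<alpha> j" and c: "0 \<le> c" and u: "0 < u"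
    and descent: "\<And>j x. x \<in> space N \<Longrightarrow>
      (\<integral>\<^sup>+s. ennreal (\<Phi> (step j s x)) \<partial>\<beta>) + ennreal (\<alpha> j) * ennreal (u * (h x)\<^sup>2)
        \<le> ennreal (\<Phi> x) + ennreal (c * (\<alpha> j)\<^sup>2)"
    and \<alpha>_sum: "filterlim (\<lambda>n. \<Sum>j\<le>n. \<alpha> j) at_top sequentially"
    and \<alpha>_sq_sum: "summable (\<lambda>j. (\<alpha> j)\<^sup>2)"
    and J_range: "\<And>K \<omega>. \<omega> \<in> space M \<Longrightarrow> J K \<omega> \<le> K"
    and J_law: "\<And>K j. j \<le> K \<Longrightarrow> prob {\<omega> \<in> space M. J K \<omega> = j} = \<alpha> j / (\<Sum>i\<le>K. \<alpha> i)"
    and J_indep: "\<And>K. indep_rvs M (count_space UNIV) (J K) (\<Pi>\<^sub>M j\<in>UNIV. \<beta>) (\<lambda>\<omega> j. \<xi> j \<omega>)"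
  shows "tendsto_in_prob M (\<lambda>K \<omega>. h (\<Theta> (J K \<omega>) \<omega>)) 0"
  unfolding tendsto_in_prob_def
proof (intro conjI allI impI)
  fix K
  show "(\<lambda>\<omega>. h (\<Theta> (J K \<omega>) \<omega>)) \<in> borel_measurable M"
    unfolding borel_measurable_iff_greater
  proof
    fix a
    have "{x \<in> space N. a < h x} \<in> sets N" by measurable
    then show "{\<omega> \<in> space M. a < h (\<Theta> (J K \<omega>) \<omega>)} \<in> events"
      using prob_random_index(1)[of "J K" K "\<lambda>x. a < h x"] J_range J_indep by blast
  qed
next
  fix e :: real assume e: "0 < e"
  \<comment> \<open>The whole budget: the initial value plus all noise contributions. Taking
    \<open>max 0\<close> matches the truncation of negative numbers by
    \<open>ennreal\<close>.\<close>
  define C where "C = max 0 (\<Phi> x0) + c * (\<Sum>j. (\<alpha> j)\<^sup>2)"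
  define B where "B j = {\<omega> \<in> space M. \<bar>h (\<Theta> j \<omega>) - 0\<bar> > e}" for j
  have tail_nonneg: "0 \<le> c * (\<Sum>j. (\<alpha> j)\<^sup>2)"
    by (intro mult_nonneg_nonneg c suminf_nonneg \<alpha>_sq_sum zero_le_power2)
  then have C_nonneg: "0 \<le> C" unfolding C_def by simp
  have B_events: "B j \<in> events" for j unfolding B_def by measurable
  have markov: "ennreal (u * e\<^sup>2 * prob (B j)) \<le> (\<integral>\<^sup>+\<omega>. ennreal (u * (h (\<Theta> j \<omega>))\<^sup>2) \<partial>M)" for j
  proof -
    have "ennreal (u * e\<^sup>2 * prob (B j)) = (\<integral>\<^sup>+\<omega>. ennreal (u * e\<^sup>2) * indicator (B j) \<omega> \<partial>M)"
      using B_events u by (simp add: nn_integral_cmult_indicator emeasure_eq_measure ennreal_mult)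
    also have "\<dots> \<le> (\<integral>\<^sup>+\<omega>. ennreal (u * (h (\<Theta> j \<omega>))\<^sup>2) \<partial>M)"
    proof (rule nn_integral_mono)
      fix \<omega>
      show "ennreal (u * e\<^sup>2) * indicator (B j) \<omega> \<le> ennreal (u * (h (\<Theta> j \<omega>))\<^sup>2)"
      proof (cases "\<omega> \<in> B j")
        case True
        then have "e\<^sup>2 \<le> (h (\<Theta> j \<omega>))\<^sup>2"
          using e by (intro abs_le_square_iff[THEN iffD1]) (auto simp: B_def)
        then show ?thesis using True u by (auto intro!: ennreal_leI)
      qed simp
    qed
    finally show ?thesis .
  qed
  have bound: "u * e\<^sup>2 * (\<Sum>j\<le>K. \<alpha> j * prob (B j)) \<le> C" for K
  proof -
    \<comment> \<open>The sum up to and including \<open>K\<close> is one over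
      \<open>j < Suc K\<close>, the form in which the telescoped bound is stated.\<close>
    have "ennreal (u * e\<^sup>2 * (\<Sum>j\<le>K. \<alpha> j * prob (B j)))
        = (\<Sum>j<Suc K. ennreal (\<alpha> j) * ennreal (u * e\<^sup>2 * prob (B j)))"
      using \<alpha>_pos u
      by (simp add: ennreal_mult[symmetric] lessThan_Suc_atMost sum_distrib_left less_imp_le mult_ac)
    also have "\<dots> \<le> (\<Sum>j<Suc K. ennreal (\<alpha> j) * (\<integral>\<^sup>+\<omega>. ennreal (u * (h (\<Theta> j \<omega>))\<^sup>2) \<partial>M))"
      by (intro sum_mono mult_left_mono markov) simp
    \<comment> \<open>The final value of \<open>\<Phi>\<close> is nonnegative as an extended real,
      so it may be inserted to match the telescoped bound.\<close>
    also have "\<dots> \<le> (\<integral>\<^sup>+\<omega>. ennreal (\<Phi> (\<Theta> (Suc K) \<omega>)) \<partial>M) + \<dots>" by simp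
    also have "\<dots> \<le> ennreal (\<Phi> x0) + (\<Sum>j<Suc K. ennreal (c * (\<alpha> j)\<^sup>2))"
      by (rule expected_decrease_sum) (use descent in auto)
    also have "\<dots> = ennreal (max 0 (\<Phi> x0)) + ennreal (c * (\<Sum>j<Suc K. (\<alpha> j)\<^sup>2))"
      using c by (simp add: sum_distrib_left del: sum.lessThan_Suc)
    also have "\<dots> \<le> ennreal (max 0 (\<Phi> x0)) + ennreal (c * (\<Sum>j. (\<alpha> j)\<^sup>2))"
      using c \<alpha>_sq_sum
      by (intro add_left_mono ennreal_leI mult_left_mono sum_le_suminf) auto
    also have "\<dots> = ennreal C"
      unfolding C_def using tail_nonneg by (intro ennreal_plus[symmetric]) auto
    finally show ?thesis using C_nonneg by (simp add: ennreal_le_iff)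
  qed
  have sum_pos: "0 < (\<Sum>i\<le>K. \<alpha> i)" for K using \<alpha>_pos by (intro sum_pos) auto
  show "(\<lambda>K. prob {\<omega> \<in> space M. e < \<bar>h (\<Theta> (J K \<omega>) \<omega>) - 0\<bar>}) \<longlonglongrightarrow> 0"
  proof (rule tendsto_sandwich[OF always_eventually always_eventually tendsto_const], safe)
    fix K
    have "{x \<in> space N. e < \<bar>h x - 0\<bar>} \<in> sets N" by measurable
    with prob_random_index(2)[of "J K" K "\<lambda>x. e < \<bar>h x - 0\<bar>"] J_range J_indep
    have "prob {\<omega> \<in> space M. e < \<bar>h (\<Theta> (J K \<omega>) \<omega>) - 0\<bar>} = (\<Sum>j\<le>K. \<alpha> j / (\<Sum>i\<le>K. \<alpha> i) * prob (B j))"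
      by (simp add: B_def J_law)
    also have "\<dots> = (\<Sum>j\<le>K. \<alpha> j * prob (B j)) / (\<Sum>i\<le>K. \<alpha> i)"
      by (simp add: sum_divide_distrib)
    also have "\<dots> \<le> (C / (u * e\<^sup>2)) / (\<Sum>i\<le>K. \<alpha> i)"
      using bound[of K] u e sum_pos[of K]
      by (intro divide_right_mono) (auto simp: field_simps)
    finally show "prob {\<omega> \<in> space M. e < \<bar>h (\<Theta> (J K \<omega>) \<omega>) - 0\<bar>} \<le> (C / (u * e\<^sup>2)) / (\<Sum>i\<le>K. \<alpha> i)" .
  next
    show "(\<lambda>K. (C / (u * e\<^sup>2)) / (\<Sum>i\<le>K. \<alpha> i)) \<longlonglongrightarrow> 0"
      by (rule real_tendsto_divide_at_top[OF tendsto_const \<alpha>_sum])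
  qed simp
qed

end

section \<open>Moments and minibatches\<close>

lemma le_one_plus_power2: "(x::real) \<le> 1 + x\<^sup>2"
proof -
  have "0 \<le> (x - 1/2)\<^sup>2" by simp
  then show ?thesis by (simp add: power2_diff power_divide)
qed

lemma integrable_norm_power2:
  assumes "f \<in> borel_measurable M" "(\<integral>\<^sup>+x. ennreal ((norm (f x))\<^sup>2) \<partial>M) \<le> ennreal C" "0 \<le> C"
  shows "integrable M (\<lambda>x. (norm (f x))\<^sup>2)" "(\<integral>x. (norm (f x))\<^sup>2 \<partial>M) \<le> C"
proof -
  show i: "integrable M (\<lambda>x. (norm (f x))\<^sup>2)"
    using assms by (intro integrableI_bounded) (auto simp: le_less_trans[OF _ ennreal_less_top])
  have "ennreal (\<integral>x. (norm (f x))\<^sup>2 \<partial>M) = (\<integral>\<^sup>+x. ennreal ((norm (f x))\<^sup>2) \<partial>M)"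
    by (intro nn_integral_eq_integral[symmetric] i) auto
  then show "(\<integral>x. (norm (f x))\<^sup>2 \<partial>M) \<le> C"
    using assms by (metis ennreal_le_iff)
qed

context prob_space
begin

lemma integrable_if_norm_power2:
  fixes f :: "'a \<Rightarrow> 'b::{banach, second_countable_topology}"
  assumes "f \<in> borel_measurable M" "integrable M (\<lambda>x. (norm (f x))\<^sup>2)"
  shows "integrable M f"
proof (rule Bochner_Integration.integrable_bound[OF _ assms(1)])
  show "integrable M (\<lambda>x. 1 + (norm (f x))\<^sup>2)" using assms by simp
  have "norm (f x) \<le> norm (1 + (norm (f x))\<^sup>2)" for x
    using le_one_plus_power2[of "norm (f x)"] by simp
  then show "AE x in M. norm (f x) \<le> norm (1 + (norm (f x))\<^sup>2)" by simp
qed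

text \<open>Jensen's inequality for the square, in the form that the variance of
  \<open>norm (f x)\<close> is nonnegative.\<close>

lemma norm_expectation_le_sqrt:
  fixes f :: "'a \<Rightarrow> 'b::{banach, second_countable_topology}"
  assumes "f \<in> borel_measurable M" "integrable M (\<lambda>x. (norm (f x))\<^sup>2)"
  shows "norm (expectation f) \<le> sqrt (expectation (\<lambda>x. (norm (f x))\<^sup>2))"
proof -
  have i: "integrable M (\<lambda>x. norm (f x))"
    using integrable_if_norm_power2[OF assms] by simp
  have "(expectation (\<lambda>x. norm (f x)))\<^sup>2 \<le> expectation (\<lambda>x. (norm (f x))\<^sup>2)"
    using variance_positive[of "\<lambda>x. norm (f x)"] variance_eq[OF i assms(2)] by simp
  then have "expectation (\<lambda>x. norm (f x)) \<le> sqrt (expectation (\<lambda>x. (norm (f x))\<^sup>2))"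
    by (rule real_le_rsqrt)
  with integral_norm_bound[of M f] show ?thesis by (rule order_trans)
qed

lemma norm_expectation_le:
  fixes f :: "'a \<Rightarrow> 'b::{banach, second_countable_topology}"
  assumes "integrable M f" "\<And>x. x \<in> space M \<Longrightarrow> norm (f x) \<le> c"
  shows "norm (expectation f) \<le> c"
proof -
  have "norm (expectation f) \<le> expectation (\<lambda>x. norm (f x))" by (rule integral_norm_bound)
  also have "\<dots> \<le> expectation (\<lambda>_. c)"
    using assms by (intro integral_mono) auto
  finally show ?thesis by (simp add: prob_space)
qed

end

text \<open>The linear term is absorbed by \<open>t \<le> 1 + t\<^sup>2\<close>, so a finite second
  moment yields an integrable majorant.\<close>

lemma integrable_quadratic_growth:
  fixes f :: "'a::real_normed_vector \<Rightarrow> 'b::{banach, second_countable_topology}"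
  assumes M: "prob_space M" and f: "f \<in> borel_measurable M"
    and sq: "integrable M (\<lambda>x. (norm x)\<^sup>2)" and b: "0 \<le> b"
    and growth: "\<And>x. norm (f x) \<le> a + b * norm x + c * (norm x)\<^sup>2"
  shows "integrable M f"
proof (rule Bochner_Integration.integrable_bound[OF _ f])
  interpret prob_space M by (rule M)
  show "integrable M (\<lambda>x. a + b + (b + c) * (norm x)\<^sup>2)" using sq by simp
  have "norm (f x) \<le> norm (a + b + (b + c) * (norm x)\<^sup>2)" for x
  proof -
    have "b * norm x \<le> b * (1 + (norm x)\<^sup>2)"
      using le_one_plus_power2 b by (rule mult_left_mono)
    with growth[of x] show ?thesis by (simp add: algebra_simps)
  qed
  then show "AE x in M. norm (f x) \<le> norm (a + b + (b + c) * (norm x)\<^sup>2)" by simp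
qed

lemma distr_pair_snd:
  assumes "prob_space M" "sigma_finite_measure N"
  shows "distr (M \<Otimes>\<^sub>M N) N snd = N"
proof (rule measure_eqI)
  interpret M: prob_space M by fact
  interpret N: sigma_finite_measure N by fact
  fix A assume "A \<in> sets (distr (M \<Otimes>\<^sub>M N) N snd)"
  then have A: "A \<in> sets N" by simp
  then have "snd -` A \<inter> space (M \<Otimes>\<^sub>M N) = space M \<times> A"
    by (auto simp: space_pair_measure dest: sets.sets_into_space)
  with A show "emeasure (distr (M \<Otimes>\<^sub>M N) N snd) A = emeasure N A"
    by (simp add: emeasure_distr N.emeasure_pair_measure_Times M.emeasure_space_1)
qed simp

text \<open>Cauchy-Schwarz for a sum of \<open>B\<close> terms costs a factor \<open>B\<close>,
  which cancels one of the two factors \<open>1 / B\<close>.\<close>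

lemma norm_mean_power2_le:
  fixes v :: "nat \<Rightarrow> 'b::real_normed_vector"
  assumes "1 \<le> B"
  shows "(norm ((1 / real B) *\<^sub>R (\<Sum>i=1..B. v i)))\<^sup>2 \<le> (1 / real B) * (\<Sum>i=1..B. (norm (v i))\<^sup>2)"
proof -
  have "(norm (\<Sum>i=1..B. v i))\<^sup>2 \<le> (\<Sum>i=1..B. norm (v i))\<^sup>2"
    by (intro power_mono norm_sum) simp
  also have "\<dots> \<le> (\<Sum>i=1..B. (norm (v i))\<^sup>2) * real B"
    using sum_squared_le_sum_of_squares[of "\<lambda>i. norm (v i)" "{1..B}"] by simp
  finally have "(1 / real B)\<^sup>2 * (norm (\<Sum>i=1..B. v i))\<^sup>2 \<le> (1 / real B)\<^sup>2 * ((\<Sum>i=1..B. (norm (v i))\<^sup>2) * real B)"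
    by (rule mult_left_mono) simp
  then show ?thesis using assms by (simp add: power2_eq_square mult_ac)
qed

section \<open>Moments of minibatch averages\<close>

locale two_laws = mu: prob_space \<mu> + nu: prob_space \<nu> for \<mu> \<nu> :: "'a measure"
begin

lemma prob_space_batch: "prob_space (batch_law B \<mu> \<nu>)"
  unfolding batch_law_def
  by (intro prob_space_pair prob_space_PiM mu.prob_space_axioms nu.prob_space_axioms)

lemma batch_measurable:
  assumes "i \<in> {1..B}"
  shows "(\<lambda>s. fst s i) \<in> batch_law B \<mu> \<nu> \<rightarrow>\<^sub>M \<mu>" "(\<lambda>s. snd s i) \<in> batch_law B \<mu> \<nu> \<rightarrow>\<^sub>M \<nu>"
  using assms unfolding batch_law_def by measurable

text \<open>The coordinate is reached in two projections, first onto a block and then onto one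
  component, each preserving the marginal law.\<close>

lemma distr_batch:
  assumes i: "i \<in> {1..B}"
  shows "distr (batch_law B \<mu> \<nu>) \<mu> (\<lambda>s. fst s i) = \<mu>" "distr (batch_law B \<mu> \<nu>) \<nu> (\<lambda>s. snd s i) = \<nu>"
proof -
  let ?P = "\<Pi>\<^sub>M i\<in>{1..B}. \<mu>" and ?Q = "\<Pi>\<^sub>M i\<in>{1..B}. \<nu>"
  interpret P: prob_space ?P by (intro prob_space_PiM mu.prob_space_axioms)
  interpret Q: prob_space ?Q by (intro prob_space_PiM nu.prob_space_axioms)
  have "distr (batch_law B \<mu> \<nu>) \<mu> (\<lambda>s. fst s i) = distr (distr (?P \<Otimes>\<^sub>M ?Q) ?P fst) \<mu> (\<lambda>x. x i)"
    unfolding batch_law_def using i by (subst distr_distr) (auto simp: comp_def)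
  then show "distr (batch_law B \<mu> \<nu>) \<mu> (\<lambda>s. fst s i) = \<mu>"
    unfolding Q.distr_pair_fst distr_PiM_component[OF mu.prob_space_axioms i] .
  have "distr (batch_law B \<mu> \<nu>) \<nu> (\<lambda>s. snd s i) = distr (distr (?P \<Otimes>\<^sub>M ?Q) ?Q snd) \<nu> (\<lambda>x. x i)"
    unfolding batch_law_def using i by (subst distr_distr) (auto simp: comp_def)
  then show "distr (batch_law B \<mu> \<nu>) \<nu> (\<lambda>s. snd s i) = \<nu>"
    unfolding distr_pair_snd[OF P.prob_space_axioms Q.sigma_finite_measure_axioms]
      distr_PiM_component[OF nu.prob_space_axioms i] .
qed

lemma batch_integral:
  fixes f :: "'a \<Rightarrow> 'b::{banach, second_countable_topology}"
  assumes i: "i \<in> {1..B}"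
  shows "integrable \<mu> f \<Longrightarrow> integrable (batch_law B \<mu> \<nu>) (\<lambda>s. f (fst s i))"
    "integrable \<mu> f \<Longrightarrow> (\<integral>s. f (fst s i) \<partial>batch_law B \<mu> \<nu>) = (\<integral>x. f x \<partial>\<mu>)"
    "integrable \<nu> f \<Longrightarrow> integrable (batch_law B \<mu> \<nu>) (\<lambda>s. f (snd s i))"
    "integrable \<nu> f \<Longrightarrow> (\<integral>s. f (snd s i) \<partial>batch_law B \<mu> \<nu>) = (\<integral>x. f x \<partial>\<nu>)"
  using integrable_distr[OF batch_measurable(1)[OF i], of f]
    integral_distr[OF batch_measurable(1)[OF i], of f]
    integrable_distr[OF batch_measurable(2)[OF i], of f]
    integral_distr[OF batch_measurable(2)[OF i], of f]
  by (simp_all add: distr_batch[OF i])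

text \<open>By linearity and the marginal laws, minibatch averages are unbiased.\<close>

lemma batch_mean:
  fixes a b :: "'a \<Rightarrow> 'b::{banach, second_countable_topology}"
  assumes "1 \<le> B" "integrable \<mu> a" "integrable \<nu> b"
  defines "D \<equiv> \<lambda>s. (1 / real B) *\<^sub>R (\<Sum>i=1..B. a (fst s i)) - (1 / real B) *\<^sub>R (\<Sum>i=1..B. b (snd s i))"
  shows "integrable (batch_law B \<mu> \<nu>) D"
    "(\<integral>s. D s \<partial>batch_law B \<mu> \<nu>) = (\<integral>x. a x \<partial>\<mu>) - (\<integral>z. b z \<partial>\<nu>)"
proof -
  have i: "integrable (batch_law B \<mu> \<nu>) (\<lambda>s. \<Sum>i=1..B. a (fst s i))"
    "integrable (batch_law B \<mu> \<nu>) (\<lambda>s. \<Sum>i=1..B. b (snd s i))"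
    using assms(2,3) by (auto intro!: Bochner_Integration.integrable_sum batch_integral)
  then show "integrable (batch_law B \<mu> \<nu>) D" unfolding D_def by simp
  have "(\<integral>s. (\<Sum>i=1..B. a (fst s i)) \<partial>batch_law B \<mu> \<nu>) = (\<Sum>i=1..B. \<integral>x. a x \<partial>\<mu>)"
    "(\<integral>s. (\<Sum>i=1..B. b (snd s i)) \<partial>batch_law B \<mu> \<nu>) = (\<Sum>i=1..B. \<integral>z. b z \<partial>\<nu>)"
    using assms(2,3) by (simp_all add: batch_integral Bochner_Integration.integral_sum)
  with i \<open>1 \<le> B\<close> show "(\<integral>s. D s \<partial>batch_law B \<mu> \<nu>) = (\<integral>x. a x \<partial>\<mu>) - (\<integral>z. b z \<partial>\<nu>)"
    unfolding D_def by (simp add: sum_constant_scaleR)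
qed

text \<open>The bound is uniform in the batch size: \<open>2 * u\<^sup>2 + 2 * v\<^sup>2\<close>
  dominates the square of \<open>u + v\<close>, and the squared norm of a mean is at most the mean
  of the squared norms. The same majorant gives integrability.\<close>

lemma batch_second_moment:
  fixes a b :: "'a \<Rightarrow> 'b::{banach, second_countable_topology}"
  assumes B: "1 \<le> B" and a: "integrable \<mu> a" "integrable \<mu> (\<lambda>x. (norm (a x))\<^sup>2)"
    and b: "integrable \<nu> b" "integrable \<nu> (\<lambda>z. (norm (b z))\<^sup>2)"
  defines "D \<equiv> \<lambda>s. (1 / real B) *\<^sub>R (\<Sum>i=1..B. a (fst s i)) - (1 / real B) *\<^sub>R (\<Sum>i=1..B. b (snd s i))"
  shows "integrable (batch_law B \<mu> \<nu>) (\<lambda>s. (norm (D s))\<^sup>2)"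
    "(\<integral>s. (norm (D s))\<^sup>2 \<partial>batch_law B \<mu> \<nu>)
      \<le> 2 * (\<integral>x. (norm (a x))\<^sup>2 \<partial>\<mu>) + 2 * (\<integral>z. (norm (b z))\<^sup>2 \<partial>\<nu>)"
proof -
  let ?S = "\<lambda>s. 2 * ((1 / real B) * (\<Sum>i=1..B. (norm (a (fst s i)))\<^sup>2))
    + 2 * ((1 / real B) * (\<Sum>i=1..B. (norm (b (snd s i)))\<^sup>2))"
  have i: "integrable (batch_law B \<mu> \<nu>) (\<lambda>s. \<Sum>i=1..B. (norm (a (fst s i)))\<^sup>2)"
    "integrable (batch_law B \<mu> \<nu>) (\<lambda>s. \<Sum>i=1..B. (norm (b (snd s i)))\<^sup>2)"
    using batch_integral(1)[OF _ a(2)] batch_integral(3)[OF _ b(2)]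
    by (auto intro!: Bochner_Integration.integrable_sum)
  then have S: "integrable (batch_law B \<mu> \<nu>) ?S" by simp
  have le: "(norm (D s))\<^sup>2 \<le> ?S s" for s
  proof -
    let ?u = "(1 / real B) *\<^sub>R (\<Sum>i=1..B. a (fst s i))" and ?v = "(1 / real B) *\<^sub>R (\<Sum>i=1..B. b (snd s i))"
    have "(norm (D s))\<^sup>2 \<le> (norm ?u + norm ?v)\<^sup>2"
      unfolding D_def by (intro power_mono norm_triangle_ineq4) simp
    also have "\<dots> \<le> 2 * (norm ?u)\<^sup>2 + 2 * (norm ?v)\<^sup>2"
      using zero_le_power2[of "norm ?u - norm ?v"] unfolding power2_sum power2_diff by linarith
    also have "\<dots> \<le> ?S s"
      by (intro add_mono mult_left_mono norm_mean_power2_le B) auto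
    finally show ?thesis .
  qed
  have "D \<in> borel_measurable (batch_law B \<mu> \<nu>)"
    using batch_mean(1)[OF B a(1) b(1)] unfolding D_def by (rule borel_measurable_integrable)
  then show D: "integrable (batch_law B \<mu> \<nu>) (\<lambda>s. (norm (D s))\<^sup>2)"
    using le by (intro Bochner_Integration.integrable_bound[OF S])
      (auto intro!: AE_I2 order_trans[OF _ abs_ge_self])
  have "(\<integral>s. (norm (D s))\<^sup>2 \<partial>batch_law B \<mu> \<nu>) \<le> (\<integral>s. ?S s \<partial>batch_law B \<mu> \<nu>)"
    by (rule integral_mono[OF D S le])
  also have "\<dots> = 2 * ((1 / real B) * (\<Sum>i=1..B. \<integral>x. (norm (a x))\<^sup>2 \<partial>\<mu>))
      + 2 * ((1 / real B) * (\<Sum>i=1..B. \<integral>z. (norm (b z))\<^sup>2 \<partial>\<nu>))"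
    using i batch_integral(1,2)[OF _ a(2)] batch_integral(3,4)[OF _ b(2)]
    by (simp add: Bochner_Integration.integral_sum)
  also have "\<dots> = 2 * (\<integral>x. (norm (a x))\<^sup>2 \<partial>\<mu>) + 2 * (\<integral>z. (norm (b z))\<^sup>2 \<partial>\<nu>)"
    using B by simp
  finally show "(\<integral>s. (norm (D s))\<^sup>2 \<partial>batch_law B \<mu> \<nu>)
      \<le> 2 * (\<integral>x. (norm (a x))\<^sup>2 \<partial>\<mu>) + 2 * (\<integral>z. (norm (b z))\<^sup>2 \<partial>\<nu>)" .
qed

end

section \<open>The loss and its approximate gradient\<close>

context potential
begin

lemma borel_g [measurable]: "g \<theta> \<in> borel_measurable borel"
  using continuous_on_compose2[OF continuous_g, of UNIV "\<lambda>y. (\<theta>, y)"]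
  by (intro borel_measurable_continuous_onI) (simp add: continuous_on_Pair)

lemma borel_grad_theta:
  "(\<lambda>(\<theta>, y). grad_theta g \<theta> y) \<in> borel_measurable (borel \<Otimes>\<^sub>M borel)"
  using borel_measurable_continuous_onI[OF continuous_grad_theta] by (simp add: borel_prod)

lemma borel_y_star: "(\<lambda>(\<theta>, z). y_star g \<theta> z) \<in> borel_measurable (borel \<Otimes>\<^sub>M borel)"
  using borel_measurable_continuous_onI[OF continuous_y_star] by (simp add: borel_prod)

lemma borel_y_star' [measurable]: "y_star g \<theta> \<in> borel_measurable borel"
  using measurable_compose[OF measurable_Pair1'[of \<theta> borel borel] borel_y_star] by simp

lemma borel_grad_theta' [measurable]: "grad_theta g \<theta> \<in> borel_measurable borel"
  using measurable_compose[OF measurable_Pair1'[of \<theta> borel borel] borel_grad_theta] by simp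

lemma borel_moreau_env [measurable]: "moreau_env \<theta> \<in> borel_measurable borel"
  unfolding moreau_env_def obj_def by measurable

lemma grad_theta_growth: "norm (grad_theta g \<theta> y) \<le> norm (grad_theta g \<theta> 0) + L_theta * norm y"
  using grad_theta_lipschitz[of \<theta> y \<theta> 0] norm_triangle_sub[of "grad_theta g \<theta> y" "grad_theta g \<theta> 0"]
  by simp

text \<open>The upper bound tests the minimum with \<open>z\<close>. The lower bound tests the
  envelope at the origin with the minimizer \<open>y\<close> for \<open>z\<close>; half of the bound
  \<open>2 * (norm (y_star g \<theta> 0))\<^sup>2 + 8 * (norm z)\<^sup>2\<close> on its squared norm
  accounts for the added 4.\<close>

lemma moreau_env_growth:
  "\<bar>moreau_env \<theta> z\<bar> \<le> (\<bar>moreau_env \<theta> 0\<bar> + (norm (y_star g \<theta> 0))\<^sup>2 + \<bar>g \<theta> 0\<bar>)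
    + norm (grad_y g \<theta> 0) * norm z + (L_y + 4) * (norm z)\<^sup>2"
proof -
  define y where "y = y_star g \<theta> z"
  have upper: "moreau_env \<theta> z \<le> \<bar>g \<theta> z\<bar>"
    using moreau_env_le[of \<theta> z z] by (simp add: obj_def)
  have "norm y \<le> norm (y_star g \<theta> 0) + 2 * norm z"
    using y_star_lipschitz[of \<theta> z \<theta> 0] norm_triangle_sub[of y "y_star g \<theta> 0"] by (simp add: y_def)
  then have "(norm y)\<^sup>2 \<le> (norm (y_star g \<theta> 0) + 2 * norm z)\<^sup>2"
    by (intro power_mono) auto
  also have "\<dots> \<le> 2 * (norm (y_star g \<theta> 0))\<^sup>2 + 8 * (norm z)\<^sup>2"
    using zero_le_power2[of "norm (y_star g \<theta> 0) - 2 * norm z"]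
    by (simp add: power2_sum power2_diff power_mult_distrib)
  finally have y: "(norm y)\<^sup>2 \<le> 2 * (norm (y_star g \<theta> 0))\<^sup>2 + 8 * (norm z)\<^sup>2" .
  have "moreau_env \<theta> 0 \<le> obj \<theta> 0 y" by (rule moreau_env_le)
  also have "\<dots> \<le> 1/2 * (norm y)\<^sup>2 + moreau_env \<theta> z"
    by (simp add: moreau_env_def obj_def y_def)
  finally have "moreau_env \<theta> 0 - (norm (y_star g \<theta> 0))\<^sup>2 - 4 * (norm z)\<^sup>2 \<le> moreau_env \<theta> z"
    using y by simp
  moreover have "0 \<le> norm (grad_y g \<theta> 0) * norm z" "0 \<le> L_y * (norm z)\<^sup>2"
    using L_y_nonneg by auto
  ultimately show ?thesis
    using upper g_growth[of \<theta> z] zero_le_power2[of "norm z"] zero_le_power2[of "norm (y_star g \<theta> 0)"]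
    unfolding distrib_right abs_le_iff by linarith
qed

end

section \<open>Gradient formula, smoothness and lower bound of the loss\<close>

locale potential_loss = potential g L_theta L_y + two_laws \<mu> \<nu>
  for g :: "real ^ 'p \<Rightarrow> real ^ 'd \<Rightarrow> real" and L_theta L_y :: real
    and \<mu> \<nu> :: "(real ^ 'd) measure" +
  assumes sets_mu: "sets \<mu> = sets borel" and sets_nu: "sets \<nu> = sets borel"
    and mu_moment: "integrable \<mu> (\<lambda>x. (norm x)\<^sup>2)"
    and nu_moment: "integrable \<nu> (\<lambda>z. (norm z)\<^sup>2)"
begin

lemma borel_mu: "f \<in> borel_measurable borel \<Longrightarrow> f \<in> borel_measurable \<mu>"
  and borel_nu: "f \<in> borel_measurable borel \<Longrightarrow> f \<in> borel_measurable \<nu>"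
  by (simp_all cong: measurable_cong_sets add: sets_mu sets_nu)

lemma integrable_g: "integrable \<mu> (g \<theta>)"
  by (rule integrable_quadratic_growth[OF mu.prob_space_axioms borel_mu[OF borel_g] mu_moment
        norm_ge_zero g_growth[folded real_norm_def]])

lemma integrable_moreau_env: "integrable \<nu> (moreau_env \<theta>)"
  by (rule integrable_quadratic_growth[OF nu.prob_space_axioms borel_nu[OF borel_moreau_env] nu_moment
        norm_ge_zero moreau_env_growth[folded real_norm_def]])

lemma integrable_grad_mu: "integrable \<mu> (grad_theta g \<theta>)"
proof (rule integrable_quadratic_growth[OF mu.prob_space_axioms _ mu_moment L_theta_nonneg])
  show "norm (grad_theta g \<theta> y) \<le> norm (grad_theta g \<theta> 0) + L_theta * norm y + 0 * (norm y)\<^sup>2" for y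
    using grad_theta_growth by simp
qed (simp add: borel_mu)

lemma integrable_grad_nu: "integrable \<nu> (\<lambda>z. grad_theta g \<theta> (y_star g \<theta> z))"
proof (rule integrable_quadratic_growth[OF nu.prob_space_axioms _ nu_moment])
  show "norm (grad_theta g \<theta> (y_star g \<theta> z))
    \<le> (norm (grad_theta g \<theta> 0) + L_theta * norm (y_star g \<theta> 0)) + (L_theta * 2) * norm z + 0 * (norm z)\<^sup>2" for z
  proof -
    have "norm (y_star g \<theta> z) \<le> norm (y_star g \<theta> 0) + 2 * norm z"
      using y_star_lipschitz[of \<theta> z \<theta> 0] norm_triangle_sub[of "y_star g \<theta> z" "y_star g \<theta> 0"] by simp
    then have "L_theta * norm (y_star g \<theta> z) \<le> L_theta * (norm (y_star g \<theta> 0) + 2 * norm z)"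
      using L_theta_nonneg by (rule mult_left_mono)
    with grad_theta_growth[of \<theta> "y_star g \<theta> z"] show ?thesis by (simp add: algebra_simps)
  qed
qed (use L_theta_nonneg borel_nu[OF measurable_compose[OF borel_y_star' borel_grad_theta']] in auto)

text \<open>Candidate gradient, differentiating the integrands with the minimizer held fixed;
  \<open>grad_loss\<close> confirms it.\<close>

definition loss_grad :: "real ^ 'p \<Rightarrow> real ^ 'p" where
  "loss_grad \<theta> = (\<integral>x. grad_theta g \<theta> x \<partial>\<mu>) - (\<integral>z. grad_theta g \<theta> (y_star g \<theta> z) \<partial>\<nu>)"

lemma loss_eq: "loss g \<mu> \<nu> \<theta> = (\<integral>x. g \<theta> x \<partial>\<mu>) - (\<integral>z. moreau_env \<theta> z \<partial>\<nu>)"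
  unfolding loss_def moreau_env_def obj_def ..

text \<open>Sum of the remainder constants of \<open>g\<close> and of the envelope, the two parts of
  the loss.\<close>

definition smoothness :: real where
  "smoothness = 2 * L_theta + 2 * L_theta\<^sup>2"

lemma smoothness_nonneg: "0 \<le> smoothness"
  using L_theta_nonneg by (simp add: smoothness_def)

text \<open>The pointwise remainders \<open>a\<close> and \<open>b\<close> have bounds that do not
  depend on the sample, and these survive integration against probability laws.\<close>

lemma loss_quadratic:
  "\<bar>loss g \<mu> \<nu> \<theta>' - loss g \<mu> \<nu> \<theta> - (\<theta>' - \<theta>) \<bullet> loss_grad \<theta>\<bar> \<le> smoothness * (norm (\<theta>' - \<theta>))\<^sup>2"
proof -
  define d where "d = \<theta>' - \<theta>"
  define a where "a x = g \<theta>' x - g \<theta> x - d \<bullet> grad_theta g \<theta> x" for x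
  define b where "b z = moreau_env \<theta>' z - moreau_env \<theta> z - d \<bullet> grad_theta g \<theta> (y_star g \<theta> z)" for z
  have ia: "integrable \<mu> a" and ib: "integrable \<nu> b"
    unfolding a_def b_def
    by (intro Bochner_Integration.integrable_diff integrable_inner_right integrable_g integrable_moreau_env
        integrable_grad_mu integrable_grad_nu)+
  have "(\<integral>x. a x \<partial>\<mu>) = (\<integral>x. g \<theta>' x \<partial>\<mu>) - (\<integral>x. g \<theta> x \<partial>\<mu>) - d \<bullet> (\<integral>x. grad_theta g \<theta> x \<partial>\<mu>)"
    unfolding a_def using integrable_g integrable_grad_mu by simp
  moreover have "(\<integral>z. b z \<partial>\<nu>) = (\<integral>z. moreau_env \<theta>' z \<partial>\<nu>) - (\<integral>z. moreau_env \<theta> z \<partial>\<nu>)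
      - d \<bullet> (\<integral>z. grad_theta g \<theta> (y_star g \<theta> z) \<partial>\<nu>)"
    unfolding b_def using integrable_moreau_env integrable_grad_nu by simp
  ultimately have "loss g \<mu> \<nu> \<theta>' - loss g \<mu> \<nu> \<theta> - d \<bullet> loss_grad \<theta> = (\<integral>x. a x \<partial>\<mu>) - (\<integral>z. b z \<partial>\<nu>)"
    by (simp add: loss_eq loss_grad_def inner_diff_right)
  moreover have "norm (\<integral>x. a x \<partial>\<mu>) \<le> L_theta * (norm d)\<^sup>2"
    using g_theta_quadratic[of \<theta>' _ \<theta>] by (intro mu.norm_expectation_le ia) (simp add: a_def d_def)
  moreover have "norm (\<integral>z. b z \<partial>\<nu>) \<le> (L_theta + 2 * L_theta\<^sup>2) * (norm d)\<^sup>2"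
    using moreau_env_quadratic[of \<theta>' _ \<theta>] by (intro nu.norm_expectation_le ib) (simp add: b_def d_def)
  ultimately show ?thesis
    unfolding smoothness_def d_def[symmetric] by (simp add: algebra_simps)
qed

lemma GDERIV_loss: "GDERIV (loss g \<mu> \<nu>) \<theta> :> loss_grad \<theta>"
  by (rule GDERIV_if_quadratic_error[OF loss_quadratic])

lemma grad_loss: "grad (loss g \<mu> \<nu>) \<theta> = loss_grad \<theta>"
  by (rule grad_eqI[OF GDERIV_loss])

lemma borel_loss: "loss g \<mu> \<nu> \<in> borel_measurable borel"
proof (rule borel_measurable_continuous_onI, rule has_derivative_continuous_on)
  show "(loss g \<mu> \<nu> has_derivative (\<lambda>h. h \<bullet> loss_grad \<theta>)) (at \<theta> within UNIV)" for \<theta>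
    using GDERIV_loss[of \<theta>] by (simp add: gderiv_def)
qed

lemma borel_loss_grad: "loss_grad \<in> borel_measurable borel"
proof -
  \<comment> \<open>The laws carry the Borel sets but need not be \<open>borel\<close> as measures,
    so joint measurability is transferred along the identity.\<close>
  have id: "(\<lambda>p. p) \<in> borel \<Otimes>\<^sub>M \<mu> \<rightarrow>\<^sub>M borel \<Otimes>\<^sub>M borel" "(\<lambda>p. p) \<in> borel \<Otimes>\<^sub>M \<nu> \<rightarrow>\<^sub>M borel \<Otimes>\<^sub>M borel"
    using measurable_ident_sets[OF sets_pair_measure_cong[OF refl sets_mu, of borel]]
      measurable_ident_sets[OF sets_pair_measure_cong[OF refl sets_nu, of borel]] by simp_all
  have "(\<lambda>p. (fst p, case p of (\<theta>, z) \<Rightarrow> y_star g \<theta> z)) \<in> borel \<Otimes>\<^sub>M borel \<rightarrow>\<^sub>M borel \<Otimes>\<^sub>M borel"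
    by (intro measurable_Pair measurable_fst borel_y_star)
  from measurable_compose[OF measurable_compose[OF id(2) this] borel_grad_theta]
  have "(\<lambda>(\<theta>, z). grad_theta g \<theta> (y_star g \<theta> z)) \<in> borel_measurable (borel \<Otimes>\<^sub>M \<nu>)"
    by (simp add: split_beta')
  from nu.borel_measurable_lebesgue_integral[OF this]
    mu.borel_measurable_lebesgue_integral[OF measurable_compose[OF id(1) borel_grad_theta]]
  show ?thesis unfolding loss_grad_def by measurable
qed

text \<open>Integrating first over \<open>z\<close> and then over \<open>x\<close> averages over an
  independent pair. The terms \<open>g \<theta> x\<close> then cancel against the first integral of
  the loss, leaving a bound free of \<theta>.\<close>

lemma loss_bounded_below: "- (\<integral>x. (norm x)\<^sup>2 \<partial>\<mu>) - (\<integral>z. (norm z)\<^sup>2 \<partial>\<nu>) \<le> loss g \<mu> \<nu> \<theta>"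
proof -
  have le: "moreau_env \<theta> z \<le> (norm x)\<^sup>2 + (norm z)\<^sup>2 + g \<theta> x" for x z
  proof -
    have "(norm (x - z))\<^sup>2 \<le> (norm x + norm z)\<^sup>2"
      by (intro power_mono norm_triangle_ineq4) simp
    also have "\<dots> \<le> 2 * ((norm x)\<^sup>2 + (norm z)\<^sup>2)"
      using zero_le_power2[of "norm x - norm z"] by (simp add: power2_sum power2_diff)
    finally show ?thesis using moreau_env_le[of \<theta> z x] by (simp add: obj_def)
  qed
  have "(\<integral>z. moreau_env \<theta> z \<partial>\<nu>) \<le> (norm x)\<^sup>2 + g \<theta> x + (\<integral>z. (norm z)\<^sup>2 \<partial>\<nu>)" for x
  proof -
    have "(\<integral>z. moreau_env \<theta> z \<partial>\<nu>) \<le> (\<integral>z. ((norm x)\<^sup>2 + g \<theta> x) + (norm z)\<^sup>2 \<partial>\<nu>)"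
      using le[of _ x] nu_moment by (intro integral_mono integrable_moreau_env) (auto simp: algebra_simps)
    then show ?thesis using nu_moment by (simp add: nu.prob_space)
  qed
  \<comment> \<open>The integrand on the left is constant in \<open>x\<close>.\<close>
  then have "(\<integral>x. (\<integral>z. moreau_env \<theta> z \<partial>\<nu>) \<partial>\<mu>) \<le> (\<integral>x. (norm x)\<^sup>2 + g \<theta> x + (\<integral>z. (norm z)\<^sup>2 \<partial>\<nu>) \<partial>\<mu>)"
    using mu_moment integrable_g by (intro integral_mono) auto
  also have "\<dots> = (\<integral>x. (norm x)\<^sup>2 \<partial>\<mu>) + (\<integral>x. g \<theta> x \<partial>\<mu>) + (\<integral>z. (norm z)\<^sup>2 \<partial>\<nu>)"
    using mu_moment integrable_g by (simp add: mu.prob_space)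
  finally show ?thesis by (simp add: loss_eq mu.prob_space)
qed

lemma measurable_sgd_step:
  assumes yt: "(\<lambda>(\<theta>, z). yt \<theta> z) \<in> borel_measurable borel"
  shows "(\<lambda>(s, \<theta>). \<theta> - a *\<^sub>R sgd_dir g yt B s \<theta>) \<in> batch_law B \<mu> \<nu> \<Otimes>\<^sub>M borel \<rightarrow>\<^sub>M borel"
proof -
  let ?N = "batch_law B \<mu> \<nu> \<Otimes>\<^sub>M (borel :: (real ^ 'p) measure)"
  have yt': "(\<lambda>(\<theta>, z). yt \<theta> z) \<in> borel_measurable (borel \<Otimes>\<^sub>M borel)"
    using yt by (simp add: borel_prod)
  have x: "(\<lambda>p. (snd p, fst (fst p) i)) \<in> ?N \<rightarrow>\<^sub>M borel \<Otimes>\<^sub>M borel"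
    and z: "(\<lambda>p. (snd p, snd (fst p) i)) \<in> ?N \<rightarrow>\<^sub>M borel \<Otimes>\<^sub>M borel" if "i \<in> {1..B}" for i
    using measurable_compose[OF measurable_fst batch_measurable(1)[OF that]]
      measurable_compose[OF measurable_fst batch_measurable(2)[OF that]]
    by (auto intro!: measurable_Pair cong: measurable_cong_sets simp: sets_mu sets_nu)
  have a: "(\<lambda>p. grad_theta g (snd p) (fst (fst p) i)) \<in> borel_measurable ?N" if "i \<in> {1..B}" for i
    using measurable_compose[OF x[OF that] borel_grad_theta] by simp
  have b: "(\<lambda>p. grad_theta g (snd p) (yt (snd p) (snd (fst p) i))) \<in> borel_measurable ?N" if "i \<in> {1..B}" for i
    using measurable_compose[OF measurable_Pair[OF measurable_snd measurable_compose[OF z[OF that] yt']]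
        borel_grad_theta] by simp
  have "(\<lambda>p. snd p - a *\<^sub>R sgd_dir g yt B (fst p) (snd p)) \<in> ?N \<rightarrow>\<^sub>M borel"
    unfolding sgd_dir_def
    by (intro borel_measurable_diff borel_measurable_scaleR borel_measurable_const measurable_snd
        borel_measurable_sum a b)
  then show ?thesis by (simp add: split_beta')
qed

end

section \<open>Bias of the stochastic direction and expected descent\<close>

locale approximate_gradient = potential_loss g L_theta L_y \<mu> \<nu>
  for g :: "real ^ 'p \<Rightarrow> real ^ 'd \<Rightarrow> real" and L_theta L_y :: real
    and \<mu> \<nu> :: "(real ^ 'd) measure" +
  fixes yt :: "real ^ 'p \<Rightarrow> real ^ 'd \<Rightarrow> real ^ 'd" and \<epsilon> :: "real ^ 'p \<Rightarrow> real" and M_x M_z V :: real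
  assumes L_theta_pos: "0 < L_theta"
    and yt_measurable: "(\<lambda>(\<theta>, z). yt \<theta> z) \<in> borel_measurable borel"
    and M_pos: "0 < M_x" "0 < M_z"
    and M_x: "\<And>\<theta>. (\<integral>\<^sup>+x. ennreal ((norm (grad_theta g \<theta> x))\<^sup>2) \<partial>\<mu>) \<le> ennreal M_x"
    and M_z_tilde: "\<And>\<theta>. (\<integral>\<^sup>+z. ennreal ((norm (grad_theta g \<theta> (yt \<theta> z)))\<^sup>2) \<partial>\<nu>) \<le> ennreal M_z"
    and M_z_star: "\<And>\<theta>. (\<integral>\<^sup>+z. ennreal ((norm (grad_theta g \<theta> (y_star g \<theta> z)))\<^sup>2) \<partial>\<nu>) \<le> ennreal M_z"
    and approx: "\<And>\<theta> z. norm (yt \<theta> z - y_star g \<theta> z) \<le> \<epsilon> \<theta>"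
    and eps_bound: "\<And>\<theta>. \<epsilon> \<theta> \<le> V * (norm (loss_grad \<theta>))\<^sup>2 / (L_theta * (sqrt M_x + sqrt M_z))"
begin

lemma borel_yt: "yt \<theta> \<in> borel_measurable borel"
  using measurable_compose[OF measurable_Pair1'[of \<theta> borel borel], of "\<lambda>(\<theta>, z). yt \<theta> z" borel] yt_measurable
  by (simp add: borel_prod)

lemma borel_grads:
  "grad_theta g \<theta> \<in> borel_measurable \<mu>"
  "(\<lambda>z. grad_theta g \<theta> (yt \<theta> z)) \<in> borel_measurable \<nu>"
  "(\<lambda>z. grad_theta g \<theta> (y_star g \<theta> z)) \<in> borel_measurable \<nu>"
  using measurable_compose[OF borel_yt borel_grad_theta'] measurable_compose[OF borel_y_star' borel_grad_theta']
  by (auto intro: borel_mu borel_nu)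

lemmas second_moments =
  integrable_norm_power2[OF borel_grads(1) M_x less_imp_le[OF M_pos(1)]]
  integrable_norm_power2[OF borel_grads(2) M_z_tilde less_imp_le[OF M_pos(2)]]
  integrable_norm_power2[OF borel_grads(3) M_z_star less_imp_le[OF M_pos(2)]]

lemma integrable_grad_yt: "integrable \<nu> (\<lambda>z. grad_theta g \<theta> (yt \<theta> z))"
  by (rule nu.integrable_if_norm_power2[OF borel_grads(2) second_moments(3)])

text \<open>The bound is the same sum of square roots that appears in the denominator of the
  accuracy condition \<open>eps_bound\<close>.\<close>

lemma norm_loss_grad_le: "norm (loss_grad \<theta>) \<le> sqrt M_x + sqrt M_z"
proof -
  have "norm (\<integral>x. grad_theta g \<theta> x \<partial>\<mu>) \<le> sqrt M_x"
    using mu.norm_expectation_le_sqrt[OF borel_grads(1) second_moments(1)] second_moments(2)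
    by (meson order_trans real_sqrt_le_mono)
  moreover have "norm (\<integral>z. grad_theta g \<theta> (y_star g \<theta> z) \<partial>\<nu>) \<le> sqrt M_z"
    using nu.norm_expectation_le_sqrt[OF borel_grads(3) second_moments(5)] second_moments(6)
    by (meson order_trans real_sqrt_le_mono)
  ultimately show ?thesis
    unfolding loss_grad_def by (intro norm_triangle_le_diff) simp
qed

text \<open>This is the mean of the stochastic direction; it differs from \<open>loss_grad\<close>
  by the bias from using \<open>yt\<close> in place of \<open>y_star\<close>.\<close>

definition approx_grad :: "real ^ 'p \<Rightarrow> real ^ 'p" where
  "approx_grad \<theta> = (\<integral>x. grad_theta g \<theta> x \<partial>\<mu>) - (\<integral>z. grad_theta g \<theta> (yt \<theta> z) \<partial>\<nu>)"

text \<open>The bias is at most \<open>L_theta * \<epsilon> \<theta>\<close>, and the accuracy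
  condition is calibrated so that its inner product with the gradient uses up no more than the
  fraction \<open>V\<close>.\<close>

lemma approx_grad_descent: "(1 - V) * (norm (loss_grad \<theta>))\<^sup>2 \<le> approx_grad \<theta> \<bullet> loss_grad \<theta>"
proof -
  let ?G = "loss_grad \<theta>" and ?S = "sqrt M_x + sqrt M_z"
  have S: "0 < ?S" using M_pos by (simp add: add_pos_pos)
  have "?G - approx_grad \<theta> = (\<integral>z. grad_theta g \<theta> (yt \<theta> z) - grad_theta g \<theta> (y_star g \<theta> z) \<partial>\<nu>)"
    by (simp add: loss_grad_def approx_grad_def integrable_grad_yt integrable_grad_nu)
  also have "norm \<dots> \<le> L_theta * \<epsilon> \<theta>"
  proof (rule nu.norm_expectation_le)
    fix z
    have "norm (grad_theta g \<theta> (yt \<theta> z) - grad_theta g \<theta> (y_star g \<theta> z))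
        \<le> L_theta * norm (yt \<theta> z - y_star g \<theta> z)"
      using grad_theta_lipschitz[of \<theta> "yt \<theta> z" \<theta> "y_star g \<theta> z"] by simp
    also have "\<dots> \<le> L_theta * \<epsilon> \<theta>"
      by (intro mult_left_mono approx L_theta_nonneg)
    finally show "norm (grad_theta g \<theta> (yt \<theta> z) - grad_theta g \<theta> (y_star g \<theta> z)) \<le> L_theta * \<epsilon> \<theta>" .
  qed (intro Bochner_Integration.integrable_diff integrable_grad_yt integrable_grad_nu)
  also have "\<dots> \<le> L_theta * (V * (norm ?G)\<^sup>2 / (L_theta * ?S))"
    by (intro mult_left_mono eps_bound L_theta_nonneg)
  also have "\<dots> = V * (norm ?G)\<^sup>2 / ?S" using L_theta_pos by simp
  finally have err: "norm (?G - approx_grad \<theta>) \<le> V * (norm ?G)\<^sup>2 / ?S" .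
  have "(?G - approx_grad \<theta>) \<bullet> ?G \<le> norm (?G - approx_grad \<theta>) * norm ?G"
    by (rule norm_cauchy_schwarz)
  \<comment> \<open>Trading one gradient norm for \<open>?S\<close> cancels the denominator in
    \<open>err\<close>.\<close>
  also have "\<dots> \<le> norm (?G - approx_grad \<theta>) * ?S"
    by (intro mult_left_mono norm_loss_grad_le) simp
  also have "\<dots> \<le> V * (norm ?G)\<^sup>2 / ?S * ?S"
    using S by (intro mult_right_mono err) simp
  also have "\<dots> = V * (norm ?G)\<^sup>2" using S by simp
  finally show ?thesis by (simp add: inner_diff_left power2_norm_eq_inner algebra_simps)
qed

text \<open>The quadratic expansion of the loss is averaged over a batch: the linear term gives the
  decrease, the quadratic one the noise term of order \<open>a\<^sup>2\<close>. Subtracting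
  \<open>m\<close> makes the loss nonnegative, so that \<open>ennreal\<close> keeps its
  value.\<close>

lemma sgd_expected_descent:
  assumes B: "1 \<le> B" and a: "0 < a" and V: "V < 1" and m: "\<And>\<theta>. m \<le> loss g \<mu> \<nu> \<theta>"
  defines "\<Phi> \<equiv> \<lambda>\<theta>. loss g \<mu> \<nu> \<theta> - m"
  shows "(\<integral>\<^sup>+s. ennreal (\<Phi> (\<theta> - a *\<^sub>R sgd_dir g yt B s \<theta>)) \<partial>batch_law B \<mu> \<nu>)
      + ennreal a * ennreal ((1 - V) * (norm (loss_grad \<theta>))\<^sup>2)
    \<le> ennreal (\<Phi> \<theta>) + ennreal ((smoothness * (2 * M_x + 2 * M_z)) * a\<^sup>2)"
proof -
  let ?\<beta> = "batch_law B \<mu> \<nu>" and ?G = "loss_grad \<theta>"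
  define D where "D s = sgd_dir g yt B s \<theta>" for s
  interpret \<beta>: prob_space ?\<beta> by (rule prob_space_batch)
  have D: "integrable ?\<beta> D" "(\<integral>s. D s \<partial>?\<beta>) = approx_grad \<theta>"
    using batch_mean[OF B integrable_grad_mu integrable_grad_yt, of \<theta> \<theta>]
    unfolding D_def sgd_dir_def approx_grad_def by auto
  have D2: "integrable ?\<beta> (\<lambda>s. (norm (D s))\<^sup>2)" "(\<integral>s. (norm (D s))\<^sup>2 \<partial>?\<beta>) \<le> 2 * M_x + 2 * M_z"
    using batch_second_moment[OF B integrable_grad_mu second_moments(1) integrable_grad_yt second_moments(3),
        of \<theta> \<theta>] second_moments(2)[of \<theta>] second_moments(4)[of \<theta>]
    unfolding D_def sgd_dir_def by auto
  \<comment> \<open>The quadratic majorant of the loss after the step; unlike the loss itself, its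
    mean is computed from two moments of \<open>D\<close>.\<close>
  define R where "R s = \<Phi> \<theta> - a * (D s \<bullet> ?G) + smoothness * a\<^sup>2 * (norm (D s))\<^sup>2" for s
  have \<Phi>_nonneg: "0 \<le> \<Phi> \<phi>" for \<phi> using m by (simp add: \<Phi>_def)
  have \<Phi>_le: "\<Phi> (\<theta> - a *\<^sub>R D s) \<le> R s" for s
    using loss_quadratic[of "\<theta> - a *\<^sub>R D s" \<theta>] a
    by (simp add: R_def \<Phi>_def power_mult_distrib mult.assoc)
  have R: "integrable ?\<beta> R" unfolding R_def using D D2 by simp
  have "(\<integral>s. R s \<partial>?\<beta>) = \<Phi> \<theta> - a * (approx_grad \<theta> \<bullet> ?G) + smoothness * a\<^sup>2 * (\<integral>s. (norm (D s))\<^sup>2 \<partial>?\<beta>)"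
    unfolding R_def using D D2 by (simp add: \<beta>.prob_space)
  also have "\<dots> \<le> \<Phi> \<theta> - a * ((1 - V) * (norm ?G)\<^sup>2) + smoothness * a\<^sup>2 * (2 * M_x + 2 * M_z)"
    using a smoothness_nonneg
    by (intro add_mono diff_mono mult_left_mono approx_grad_descent D2 mult_nonneg_nonneg) auto
  finally have ER: "(\<integral>s. R s \<partial>?\<beta>) + a * ((1 - V) * (norm ?G)\<^sup>2)
      \<le> \<Phi> \<theta> + smoothness * (2 * M_x + 2 * M_z) * a\<^sup>2"
    by (simp add: mult_ac)
  \<comment> \<open>Nonnegativity permits the passage from the extended integral of \<open>R\<close>
    to its real mean.\<close>
  have R_nonneg: "0 \<le> R s" for s using \<Phi>_le[of s] \<Phi>_nonneg[of "\<theta> - a *\<^sub>R D s"] by linarith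
  have "(\<integral>\<^sup>+s. ennreal (\<Phi> (\<theta> - a *\<^sub>R D s)) \<partial>?\<beta>) \<le> (\<integral>\<^sup>+s. ennreal (R s) \<partial>?\<beta>)"
    by (intro nn_integral_mono ennreal_leI \<Phi>_le)
  also have "\<dots> = ennreal (\<integral>s. R s \<partial>?\<beta>)"
    by (intro nn_integral_eq_integral R) (use R_nonneg in auto)
  finally have "(\<integral>\<^sup>+s. ennreal (\<Phi> (\<theta> - a *\<^sub>R D s)) \<partial>?\<beta>) + ennreal a * ennreal ((1 - V) * (norm ?G)\<^sup>2)
      \<le> ennreal (\<integral>s. R s \<partial>?\<beta>) + ennreal (a * ((1 - V) * (norm ?G)\<^sup>2))"
    using a V by (simp add: ennreal_mult add_right_mono)
  also have "\<dots> = ennreal ((\<integral>s. R s \<partial>?\<beta>) + a * ((1 - V) * (norm ?G)\<^sup>2))"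
    using a V R_nonneg by (intro ennreal_plus[symmetric]) auto
  also have "\<dots> \<le> ennreal (\<Phi> \<theta> + smoothness * (2 * M_x + 2 * M_z) * a\<^sup>2)"
    by (rule ennreal_leI[OF ER])
  also have "\<dots> = ennreal (\<Phi> \<theta>) + ennreal (smoothness * (2 * M_x + 2 * M_z) * a\<^sup>2)"
    using \<Phi>_nonneg smoothness_nonneg M_pos by (intro ennreal_plus) auto
  finally show ?thesis unfolding D_def .
qed

end

section \<open>Convergence in probability of the gradient norm at a random iterate\<close>

theorem corollary3p11:
  fixes \<mu> \<nu> :: "(real ^ 'd) measure"
    and g :: "real ^ 'p \<Rightarrow> real ^ 'd \<Rightarrow> real"
    and yt :: "real ^ 'p \<Rightarrow> real ^ 'd \<Rightarrow> real ^ 'd"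
    and L_inf L_theta L_y eps_p V U M_x M_z M_tilde M_L :: real
    and S :: "(real ^ 'p) set"
    and \<epsilon> :: "real ^ 'p \<Rightarrow> real"
    and \<alpha> :: "nat \<Rightarrow> real"
    and B :: nat
    and M :: "'w measure"
    and \<xi> :: "nat \<Rightarrow> 'w \<Rightarrow> (nat \<Rightarrow> real ^ 'd) \<times> (nat \<Rightarrow> real ^ 'd)"
    and \<theta>\<^sub>0 :: "real ^ 'p"
    and \<Theta> :: "nat \<Rightarrow> 'w \<Rightarrow> real ^ 'p"
    and J :: "nat \<Rightarrow> 'w \<Rightarrow> nat"
  assumes mu: "prob_space \<mu>" "sets \<mu> = sets borel"
    and nu: "prob_space \<nu>" "sets \<nu> = sets borel"
    and mu_moment: "integrable \<mu> (\<lambda>x. (norm x)\<^sup>2)"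
    and nu_moment: "integrable \<nu> (\<lambda>z. (norm z)\<^sup>2)"
    and convex: "\<And>\<theta>. convex_on UNIV (g \<theta>)"
    and g_C1: "C1 (\<lambda>(\<theta>, y). g \<theta> y)"
    and L_theta_pos: "0 < L_theta"
    and lip_theta: "L_theta-lipschitz_on UNIV (\<lambda>(\<theta>, y). grad_theta g \<theta> y)"
    and lip_y: "L_y-lipschitz_on UNIV (\<lambda>(\<theta>, y). grad_y g \<theta> y)"
    and second_partials: "has_second_partials_theta g"
    and loss_bdd: "open S" "S \<noteq> {}" "\<And>\<theta>. \<theta> \<in> S \<Longrightarrow> L_inf \<le> loss g \<mu> \<nu> \<theta>"
    and yt_measurable: "(\<lambda>(\<theta>, z). yt \<theta> z) \<in> borel_measurable borel"
    and constants_pos: "0 < M_x" "0 < M_z" "0 < M_L"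
    and M_x: "\<And>\<theta>. (\<integral>\<^sup>+x. ennreal ((norm (grad_theta g \<theta> x))\<^sup>2) \<partial>\<mu>) < ennreal M_x"
    and M_z_tilde:
      "\<And>\<theta>. (\<integral>\<^sup>+z. ennreal ((norm (grad_theta g \<theta> (yt \<theta> z)))\<^sup>2) \<partial>\<nu>) < ennreal M_z"
    and M_z_star:
      "\<And>\<theta>. (\<integral>\<^sup>+z. ennreal ((norm (grad_theta g \<theta> (y_star g \<theta> z)))\<^sup>2) \<partial>\<nu>) < ennreal M_z"
    and M_tilde: "M_tilde = M_x + M_z + 2 * sqrt (M_x * M_z)"
    and M_L: "\<And>\<theta>. (norm (grad (loss g \<mu> \<nu>) \<theta>))\<^sup>2 \<le> M_L"
    and eps_p: "0 < eps_p"
      "\<And>\<theta> z. norm ((yt \<theta> z - z) + grad_y g \<theta> (yt \<theta> z)) < eps_p"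
    and V: "0 < V" "V < 1"
    and U: "U = 1 - V"
    and approx: "\<And>\<theta> z. norm (yt \<theta> z - y_star g \<theta> z) < \<epsilon> \<theta>"
    and eps_bound: "\<And>\<theta>. \<epsilon> \<theta> \<le>
        V * (norm (grad (loss g \<mu> \<nu>) \<theta>))\<^sup>2 / (L_theta * (sqrt M_x + sqrt M_z))"
    and alpha_pos: "\<And>j. 0 < \<alpha> j"
    and alpha_decreasing: "decseq \<alpha>"
    and alpha_sum: "filterlim (\<lambda>n. \<Sum>j\<le>n. \<alpha> j) at_top sequentially"
    and alpha_sq_sum: "summable (\<lambda>j. (\<alpha> j)\<^sup>2)"
    and alpha_0: "\<alpha> 0 \<le> U * M_L / (L_theta * M_tilde)"
    and prob: "prob_space M"
    and batch_size: "1 \<le> B"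
    and xi_law: "\<And>j. distr M (batch_law B \<mu> \<nu>) (\<xi> j) = batch_law B \<mu> \<nu>"
    and xi_indep: "prob_space.indep_vars M (\<lambda>j. batch_law B \<mu> \<nu>) \<xi> UNIV"
    and sgd_init: "\<And>\<omega>. \<omega> \<in> space M \<Longrightarrow> \<Theta> 0 \<omega> = \<theta>\<^sub>0"
    and sgd_step: "\<And>j \<omega>. \<omega> \<in> space M \<Longrightarrow>
        \<Theta> (Suc j) \<omega> = \<Theta> j \<omega> - \<alpha> j *\<^sub>R sgd_dir g yt B (\<xi> j \<omega>) (\<Theta> j \<omega>)"
    and J_range: "\<And>K \<omega>. \<omega> \<in> space M \<Longrightarrow> J K \<omega> \<in> {0..K}"
    and J_law: "\<And>K j. j \<le> K \<Longrightarrow>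
        measure M {\<omega> \<in> space M. J K \<omega> = j} = \<alpha> j / (\<Sum>i\<le>K. \<alpha> i)"
    and J_indep: "\<And>K. indep_rvs M (count_space UNIV) (J K)
        (\<Pi>\<^sub>M j\<in>UNIV. batch_law B \<mu> \<nu>) (\<lambda>\<omega> j. \<xi> j \<omega>)"
  shows "tendsto_in_prob M
      (\<lambda>K \<omega>. norm (grad (loss g \<mu> \<nu>) (\<Theta> (J K \<omega>) \<omega>))) 0"
proof -
  interpret M: prob_space M by (rule prob)
  interpret two_laws \<mu> \<nu>
    by (intro two_laws.intro mu nu)
  interpret potential_loss g L_theta L_y \<mu> \<nu>
    by unfold_locales (fact convex g_C1 lip_theta lip_y mu nu mu_moment nu_moment)+
  interpret approximate_gradient g L_theta L_y \<mu> \<nu> yt \<epsilon> M_x M_z V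
  proof unfold_locales
    show "\<epsilon> \<theta> \<le> V * (norm (loss_grad \<theta>))\<^sup>2 / (L_theta * (sqrt M_x + sqrt M_z))" for \<theta>
      using eps_bound[of \<theta>] by (simp add: grad_loss)
  qed (use L_theta_pos yt_measurable constants_pos M_x M_z_tilde M_z_star approx in
      \<open>auto intro: less_imp_le\<close>)
  interpret stochastic_iteration M "batch_law B \<mu> \<nu>" \<xi> borel
    "\<lambda>j s \<theta>. \<theta> - \<alpha> j *\<^sub>R sgd_dir g yt B s \<theta>" \<theta>\<^sub>0 \<Theta>
    by unfold_locales
      (use xi_law xi_indep sgd_init sgd_step measurable_sgd_step[OF yt_measurable] in auto)
  \<comment> \<open>The lower bound on the loss from the transport cost, uniform in \<theta>, so
    that \<open>\<Phi>\<close> is nonnegative along every trajectory.\<close>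
  define m where "m = - (\<integral>x. (norm x)\<^sup>2 \<partial>\<mu>) - (\<integral>z. (norm z)\<^sup>2 \<partial>\<nu>)"
  have "tendsto_in_prob M (\<lambda>K \<omega>. norm (loss_grad (\<Theta> (J K \<omega>) \<omega>))) 0"
  \<comment> \<open>\<open>u\<close> is the share of the squared gradient left after the bias, and
    \<open>c\<close> is the smoothness constant times the second-moment bound of the stochastic
    direction.\<close>
  proof (rule tendsto_in_prob_random_index[where \<Phi> = "\<lambda>\<theta>. loss g \<mu> \<nu> \<theta> - m" and u = "1 - V"
        and h = "\<lambda>\<theta>. norm (loss_grad \<theta>)" and J = J and \<alpha> = \<alpha>
        and c = "smoothness * (2 * M_x + 2 * M_z)"])
    show "(\<lambda>\<theta>. loss g \<mu> \<nu> \<theta> - m) \<in> borel_measurable borel"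
      using borel_loss by measurable
    show "(\<lambda>\<theta>. norm (loss_grad \<theta>)) \<in> borel_measurable borel"
      using borel_loss_grad by measurable
    show "0 < 1 - V" using V by simp
    show "0 \<le> smoothness * (2 * M_x + 2 * M_z)"
      using smoothness_nonneg constants_pos by simp
    show "(\<integral>\<^sup>+s. ennreal (loss g \<mu> \<nu> (\<theta> - \<alpha> j *\<^sub>R sgd_dir g yt B s \<theta>) - m) \<partial>batch_law B \<mu> \<nu>)
        + ennreal (\<alpha> j) * ennreal ((1 - V) * (norm (loss_grad \<theta>))\<^sup>2)
      \<le> ennreal (loss g \<mu> \<nu> \<theta> - m)
        + ennreal (smoothness * (2 * M_x + 2 * M_z) * (\<alpha> j)\<^sup>2)" for j \<theta>
      by (rule sgd_expected_descent[OF batch_size alpha_pos V(2)])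
        (simp add: m_def loss_bounded_below)
    show "J K \<omega> \<le> K" if "\<omega> \<in> space M" for K \<omega>
      using J_range[OF that, of K] by simp
  qed (fact alpha_pos alpha_sum alpha_sq_sum J_law J_indep)+
  then show ?thesis unfolding grad_loss .
qed

end
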